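(* Let $n\ge2$ be an integer, $a\in\mathbb R\setminus\{0\}$, and let $\widetilde R_\varepsilon(x,y)=R_0(y)+\varepsilon A_1(y)\cos x+\varepsilon aA_n(y)\cos(nx)$ on $\mathbb R\times(0,1)$, with $R_0,A_k$ as in the context. Put $$\Lambda_n(a)=-\frac{\sinh(n/2)}{a\,n^2\sinh(1/2)}.$$ Assume that $U_{n-1}'(c)\ne0$ for every $c\in(-1,1)$ satisfying $U_{n-1}(c)=\Lambda_n(a)$, and that $\Lambda_n(a)\notin\{n,(-1)^{n-1}n\}$. Then, for $|\varepsilon|\neq0$ sufficiently small, all critical points of $\widetilde R_\varepsilon$ near the centerline (i.e. in $\mathbb R\times(\frac12-\delta,\frac12+\delta)$ for some $\delta>0$ independent of $\varepsilon$) are isolated and nondegenerate. There are always two axial critical points $P_{0,\varepsilon}=(0,y_{0,\varepsilon})$, $P_{\pi,\varepsilon}=(\pi,y_{\pi,\varepsilon})$ (modulo $2\pi$ in $x$), with $$y_{0,\varepsilon}=\frac12+\frac\varepsilon{2\pi^2}\Big[\frac{1+\pi^2}{\cosh(1/2)}+a\frac{n^2+\pi^2}{\cosh(n/2)}\Big]+O(\varepsilon^2),$$ $$y_{\pi,\varepsilon}=\frac12-\frac\varepsilon{2\pi^2}\Big[\frac{1+\pi^2}{\cosh(1/2)}-a(-1)^n\frac{n^2+\pi^2}{\cosh(n/2)}\Big]+O(\varepsilon^2).$$ In addition, every solution $c_j\in(-1,1)$ of $U_{n-1}(c)=\Lambda_n(a)$ generates two non-axial critical points $$P_{j,\varepsilon}^\pm=\Big(\pm\arccos(c_j)+O(\varepsilon),\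 \tfrac12+\varepsilon Y_j+O(\varepsilon^2)\Big)\pmod{2\pi\text{ in }x},$$ where $$Y_j=\frac1{2\pi^2}\Big[\frac{1+\pi^2}{\cosh(1/2)}c_j+a\frac{n^2+\pi^2}{\cosh(n/2)}T_n(c_j)\Big].$$
   Context: $R_0(y)=\frac1{2\pi}\log\big(\frac2\pi\sin\pi y\big)$ is the Robin function of the flat strip $\mathbb R\times(0,1)$. For integers $k\ge1$, $$A_k(y)=\int_{\mathbb R}\cos(ks)\Big(\frac12\frac{\sin\pi y}{\cosh\pi s+\cos\pi y}\Big)^2ds=\frac1{2\sinh k}\Big[\frac k\pi\cosh(ky)-\sinh(ky)\cot(\pi y)\Big].$$ $T_n$ and $U_{n-1}$ are the Chebyshev polynomials of the first and second kind: $T_n(\cos x)=\cos nx$, $\sin(nx)=\sin x\,U_{n-1}(\cos x)$. ($\widetilde R_\varepsilon$ is the first-order approximation in $\varepsilon$ of the Robin function of the channel $0<y<1+\varepsilon(\cos x+a\cos nx)$.) A critical point is nondegenerate if the Hessian is invertible there. *)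

theory Defs
  imports
    "HOL-Analysis.Analysis"
    "HOL-Computational_Algebra.Polynomial"
    "HOL-Library.Landau_Symbols"
    "HOL-Library.Real_Mod"
begin

fun cheb_T :: "nat \<Rightarrow> real poly" where
  "cheb_T 0 = 1"
| "cheb_T (Suc 0) = [:0, 1:]"
| "cheb_T (Suc (Suc n)) = [:0, 2:] * cheb_T (Suc n) - cheb_T n"

fun cheb_U :: "nat \<Rightarrow> real poly" where
  "cheb_U 0 = 1"
| "cheb_U (Suc 0) = [:0, 2:]"
| "cheb_U (Suc (Suc n)) = [:0, 2:] * cheb_U (Suc n) - cheb_U n"

lemma poly_cheb_T_cos: "poly (cheb_T n) (cos x) = cos (real n * x)"
proof (induction n rule: cheb_T.induct)
  case (3 n)
  have "cos (real (Suc (Suc n)) * x) + cos (real n * x) = 2 * cos x * cos (real (Suc n) * x)"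
    using cos_add[of "real (Suc n) * x" x] cos_diff[of "real (Suc n) * x" x]
    by (simp add: algebra_simps)
  with 3 show ?case by simp
qed simp_all

lemma poly_cheb_U_cos: "sin x * poly (cheb_U n) (cos x) = sin (real (Suc n) * x)"
proof (induction n rule: cheb_U.induct)
  case (3 n)
  have "sin (real (Suc (Suc (Suc n))) * x) + sin (real (Suc n) * x)
          = 2 * cos x * sin (real (Suc (Suc n)) * x)"
    using sin_add[of "real (Suc (Suc n)) * x" x] sin_diff[of "real (Suc (Suc n)) * x" x]
    by (simp add: algebra_simps)
  moreover have "sin x * poly (cheb_U (Suc (Suc n))) (cos x)
      = 2 * cos x * (sin x * poly (cheb_U (Suc n)) (cos x)) - sin x * poly (cheb_U n) (cos x)"
    by (simp add: algebra_simps)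
  ultimately show ?case using 3 by simp
qed (simp_all add: sin_double)

lemma poly_eq_if_eq_on_interval:
  fixes p q :: "real poly"
  assumes "\<And>t. \<lbrakk>-1 < t; t < 1\<rbrakk> \<Longrightarrow> poly p t = poly q t"
  shows "p = q"
proof (rule ccontr)
  assume "p \<noteq> q"
  then have "finite {t. poly (p - q) t = 0}"
    by (intro poly_roots_finite) simp
  moreover have "{-1<..<1::real} \<subseteq> {t. poly (p - q) t = 0}"
    using assms by auto
  ultimately have "finite {-1<..<1::real}"
    using finite_subset by blast
  then show False
    by (simp add: infinite_Ioo)
qed

lemma cheb_T_unique: "(\<forall>x. poly p (cos x) = cos (real n * x)) \<longleftrightarrow> p = cheb_T n"
proof
  assume *: "\<forall>x. poly p (cos x) = cos (real n * x)"
  show "p = cheb_T n"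
  proof (rule poly_eq_if_eq_on_interval)
    fix t :: real assume "-1 < t" "t < 1"
    then show "poly p t = poly (cheb_T n) t"
      using *[rule_format, of "arccos t"] poly_cheb_T_cos[of n "arccos t"] by simp
  qed
qed (simp add: poly_cheb_T_cos)

lemma cheb_U_unique:
  "(\<forall>x. sin x * poly p (cos x) = sin (real (Suc n) * x)) \<longleftrightarrow> p = cheb_U n"
proof
  assume *: "\<forall>x. sin x * poly p (cos x) = sin (real (Suc n) * x)"
  show "p = cheb_U n"
  proof (rule poly_eq_if_eq_on_interval)
    fix t :: real assume t: "-1 < t" "t < 1"
    then have "sin (arccos t) \<noteq> 0"
      using sin_arccos_nonzero by simp
    moreover have "sin (arccos t) * poly p t = sin (arccos t) * poly (cheb_U n) t"
      using *[rule_format, of "arccos t"] poly_cheb_U_cos[of "arccos t" n] t by simp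
    ultimately show "poly p t = poly (cheb_U n) t"
      by simp
  qed
qed (metis poly_cheb_U_cos)

definition critical_points :: "(real \<times> real \<Rightarrow> real) \<Rightarrow> (real \<times> real) set \<Rightarrow> (real \<times> real) set" where
  "critical_points f S = {p \<in> S. (f has_derivative (\<lambda>_. 0)) (at p)}"

definition partial_x :: "(real \<times> real \<Rightarrow> real) \<Rightarrow> real \<times> real \<Rightarrow> real" where
  "partial_x f = (\<lambda>(x, y). deriv (\<lambda>t. f (t, y)) x)"

definition partial_y :: "(real \<times> real \<Rightarrow> real) \<Rightarrow> real \<times> real \<Rightarrow> real" where
  "partial_y f = (\<lambda>(x, y). deriv (\<lambda>t. f (x, t)) y)"

definition hessian :: "(real \<times> real \<Rightarrow> real) \<Rightarrow> real \<times> real \<Rightarrow> real ^ 2 ^ 2" where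
  "hessian f p = vector
     [vector [partial_x (partial_x f) p, partial_y (partial_x f) p],
      vector [partial_x (partial_y f) p, partial_y (partial_y f) p]]"

definition nondegenerate_at :: "(real \<times> real \<Rightarrow> real) \<Rightarrow> real \<times> real \<Rightarrow> bool" where
  "nondegenerate_at f p \<longleftrightarrow> invertible (hessian f p)"

definition R0 :: "real \<Rightarrow> real" where
  "R0 y = 1 / (2 * pi) * ln (2 / pi * sin (pi * y))"

definition A :: "nat \<Rightarrow> real \<Rightarrow> real" where
  "A k y = (LINT s|lborel.
     cos (real k * s) * (1 / 2 * (sin (pi * y) / (cosh (pi * s) + cos (pi * y))))\<^sup>2)"

text \<open>Meaningful on \<open>\<real> \<times> (0,1)\<close> only.\<close>

definition R_approx :: "nat \<Rightarrow> real \<Rightarrow> real \<Rightarrow> real \<times> real \<Rightarrow> real" where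
  "R_approx n a \<epsilon> = (\<lambda>(x, y).
     R0 y + \<epsilon> * A 1 y * cos x + \<epsilon> * a * A n y * cos (real n * x))"

definition Lam :: "nat \<Rightarrow> real \<Rightarrow> real" where
  "Lam n a = - (sinh (real n / 2) / (a * (real n)\<^sup>2 * sinh (1 / 2)))"

definition Yshift :: "nat \<Rightarrow> real \<Rightarrow> real \<Rightarrow> real" where
  "Yshift n a c = 1 / (2 * pi\<^sup>2) *
     ((1 + pi\<^sup>2) / cosh (1 / 2) * c
      + a * (((real n)\<^sup>2 + pi\<^sup>2) / cosh (real n / 2)) * poly (cheb_T n) c)"

definition midstrip :: "real \<Rightarrow> (real \<times> real) set" where
  "midstrip \<delta> = UNIV \<times> {1 / 2 - \<delta> <..< 1 / 2 + \<delta>}"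

text \<open>The axes are the lines \<open>x = m \<pi>\<close>, about which \<open>R_approx\<close> is symmetric.\<close>

definition axial :: "real \<times> real \<Rightarrow> bool" where
  "axial p \<longleftrightarrow> (\<exists>m::int. fst p = of_int m * pi)"

end

theory Submission
  imports Defs "HOL-Complex_Analysis.Complex_Analysis" "HOL-Real_Asymp.Real_Asymp"
    "HOL-Probability.Sinc_Integral"
begin

text \<open>
  The Fourier integral \<open>A k\<close> is evaluated in closed form by integrating over a rectangle of
  height \<open>2\<close>, the period of \<open>cosh (\<pi> z)\<close>. For \<open>\<epsilon> \<noteq> 0\<close> the critical point equations then read
  \<open>sin x (A\<^sub>1(y) + n a A\<^sub>n(y) U\<^sub>n\<^sub>-\<^sub>1(cos x)) = 0\<close> and \<open>cot (\<pi> y) / 2 + \<epsilon> H(x, y) = 0\<close>. The first one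
  does not involve \<open>\<epsilon>\<close>: its solutions near the centerline are the axes and curves
  \<open>cos x = \<gamma>(y)\<close>, one through each root \<open>c\<close>, by the inverse function theorem for \<open>U\<^sub>n\<^sub>-\<^sub>1\<close>. Along
  each of them the second equation is the scalar equation \<open>y = 1/2 + arctan (2 \<epsilon> H) / \<pi>\<close>, solved by the
  intermediate value theorem, and expanding the arctangent gives the asymptotics. The hypotheses
  on \<open>U\<^sub>n\<^sub>-\<^sub>1\<close> say that the \<open>x\<close>-derivative of the perturbation has only simple zeros on the centerline;
  by compactness this persists near it and makes all Hessians invertible for small \<open>\<epsilon>\<close>.
\<close>

subsection \<open>Closed form of the Fourier integral\<close>

text \<open>At \<open>\<epsilon> = 0\<close> every point of the centerline is critical and the
  Hessian there is singular, so the implicit function theorem cannot be applied to the gradient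
  itself. Since \<open>R0\<close> does not depend on \<open>x\<close>, the whole
  \<open>x\<close>-equation carries a factor \<open>\<epsilon>\<close>; dividing by it gives a
  system with a nonsingular limit, and at critical points the Hessian determinant is
  \<open>\<epsilon>\<close> times a quantity that stays away from 0. The limit could degenerate in
  two ways: a multiple root in (-1, 1), or a root curve that meets an axis, that is, a root at 1 or
  -1. There \<open>cheb_U (n - 1)\<close> takes the values n and (-1)^(n-1) n, which explains the
  two values forbidden for \<open>Lam n a\<close>. The integral \<open>A\<close> is never
  differentiated under the integral sign: it is replaced by the closed form \<open>B\<close> on the
  open strip 1/4 < y < 3/4, which contains all heights considered later.\<close>

lemma cosh_plus_cos_eq_0:
  fixes z :: complex
  assumes y: "1/4 < y" "y < 3/4" and z: "-1/4 < Im z" "Im z < 9/4"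
    and eq: "cosh (of_real pi * z) + of_real (cos (pi * y)) = 0"
  shows "z = \<i> * of_real (1 - y) \<or> z = \<i> * of_real (1 + y)"
proof -
  have "cos (\<i> * (of_real pi * z)) = cos (of_real (pi - pi * y))"
    using eq by (simp add: cosh_conv_cos cos_of_real[symmetric] cos_diff eq_neg_iff_add_eq_0 del: cos_of_real)
  then obtain m where m: "m \<in> \<int>"
    "\<i> * (of_real pi * z) = of_real (pi - pi * y) + of_real (2 * m * pi) \<or>
     \<i> * (of_real pi * z) = - of_real (pi - pi * y) + of_real (2 * m * pi)"
    by (auto simp: complex_cos_eq)
  from m(1) obtain j :: int where j: "m = of_int j" by (auto elim: Ints_cases)
  \<comment> \<open>The strip contains the heights 0 to 2 of the contour with margin 1/4. The bounds
    1/4 < y < 3/4 keep the neighbouring zeros i (y - 1) and i (3 - y) out of it, so only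
    \<open>j = -1\<close> and \<open>j = 0\<close> survive.\<close>
  have cases: "(Re z = 0 \<and> Im z = - (1 - y) - 2 * j) \<or> (Re z = 0 \<and> Im z = (1 - y) - 2 * j)"
    using m(2)
  proof
    assume "\<i> * (of_real pi * z) = of_real (pi - pi * y) + of_real (2 * m * pi)"
    then have "pi * Re z = 0" "- (pi * Im z) = pi - pi * y + 2 * j * pi"
      by (auto simp: complex_eq_iff j)
    then have "Re z = 0" "pi * Im z = pi * (- (1 - y) - 2 * j)"
      by (auto simp: algebra_simps)
    then show ?thesis by (subst (asm) mult_left_cancel) auto
  next
    assume "\<i> * (of_real pi * z) = - of_real (pi - pi * y) + of_real (2 * m * pi)"
    then have "pi * Re z = 0" "- (pi * Im z) = - (pi - pi * y) + 2 * j * pi"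
      by (auto simp: complex_eq_iff j)
    then have "Re z = 0" "pi * Im z = pi * ((1 - y) - 2 * j)"
      by (auto simp: algebra_simps)
    then show ?thesis by (subst (asm) mult_left_cancel) auto
  qed
  then show ?thesis
  proof
    assume *: "Re z = 0 \<and> Im z = - (1 - y) - 2 * j"
    then have "real_of_int j < 0" "real_of_int j > - 2" using y z by linarith+
    then have "j = -1" by linarith
    then show ?thesis using * by (auto simp: complex_eq_iff)
  next
    assume *: "Re z = 0 \<and> Im z = (1 - y) - 2 * j"
    then have "real_of_int j < 1" "real_of_int j > - 1" using y z by linarith+
    then have "j = 0" by linarith
    then show ?thesis using * by (auto simp: complex_eq_iff)
  qed
qed

text \<open>On the real line the real part is four times the integrand of \<open>A k y\<close>. With
  the exponential in place of the cosine, a shift by 2 i only multiplies the kernel by a constant,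
  and the kernel stays bounded by its denominator in the upper half-plane.\<close>

definition A_kernel :: "nat \<Rightarrow> real \<Rightarrow> complex \<Rightarrow> complex" where
  "A_kernel k y z = exp (\<i> * of_nat k * z) * (of_real (sin (pi * y)))\<^sup>2
                / (cosh (of_real pi * z) + of_real (cos (pi * y)))\<^sup>2"

text \<open>\<open>B k\<close> agrees with \<open>A k\<close> on \<open>(1/4, 3/4)\<close>, see \<open>A_eq_B\<close>.\<close>

definition B :: "nat \<Rightarrow> real \<Rightarrow> real" where
  "B k y = 1 / (2 * sinh (real k)) *
     (real k / pi * cosh (real k * y) - sinh (real k * y) * cot (pi * y))"

text \<open>
  Subtracting the derivative of \<open>exp (\<i> k z) sinh (\<pi> z) / (\<pi> D z)\<close>, where \<open>D\<close> is the denominator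
  \<open>cosh (\<pi> z) + cos (\<pi> y)\<close>, turns the double poles of the kernel into simple ones.
\<close>

lemma A_kernel_rect:
  assumes y: "1/4 < y" "y < 3/4" and R: "0 < R"
  shows "(A_kernel k y has_contour_integral
            of_real (4 * exp (- real k) * (real k / pi * cosh (real k * y) - sinh (real k * y) * cot (pi * y))))
          (rectpath (of_real (-R)) (of_real R + 2 * \<i>))"
proof -
  define c where "c = (of_real (cos (pi * y)) :: complex)"
  define s where "s = (of_real (sin (pi * y)) :: complex)"
  define S where "S = {z. -1/4 < Im z} \<inter> {z. Im z < 9/4}"
  define p q where "p = \<i> * of_real (1 - y)" and "q = \<i> * of_real (1 + y)"
  define K where "K = (of_nat k :: complex)"
  define P where "P = (of_real pi :: complex)"
  define D where "D = (\<lambda>z. cosh (P * z) + c)"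
  define G where "G = (\<lambda>z. exp (\<i> * K * z) * sinh (P * z) / (P * D z))"
  define u where "u = (\<lambda>z. exp (\<i> * K * z) * (\<i> * K * sinh (P * z) / P + c))"
  define h where "h = (\<lambda>z. u z / D z)"
  let ?\<gamma> = "rectpath (of_real (-R)) (of_real R + 2 * \<i>)"
  have sin0: "sin (pi * y) \<noteq> 0"
    using sin_gt_zero[of "pi * y"] y by (simp add: mult.commute)
  have [simp]: "P \<noteq> 0" by (simp add: P_def)
  have cs: "s\<^sup>2 = 1 - c\<^sup>2"
    unfolding s_def c_def of_real_power[symmetric] sin_squared_eq by simp
  have D0: "D z \<noteq> 0" if "z \<in> S - {p, q}" for z
    using cosh_plus_cos_eq_0[OF y, of z] that unfolding D_def P_def c_def p_def q_def S_def by auto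
  have S: "open S" "connected S"
    unfolding S_def
    by (intro open_Int convex_connected convex_Int convex_halfspace_Im_gt convex_halfspace_Im_lt
        open_halfspace_Im_gt open_halfspace_Im_lt)+
  have pq: "p \<in> S" "q \<in> S" "p \<noteq> q" using y by (auto simp: p_def q_def S_def complex_eq_iff)
  have path: "path_image ?\<gamma> \<subseteq> S - {p, q}"
    using y R unfolding S_def p_def q_def
    by (subst path_image_rectpath_cbox_minus_box) (auto simp: in_cbox_complex_iff in_box_complex_iff)
  have G': "(G has_field_derivative (A_kernel k y z + h z)) (at z within S - {p, q})" if "z \<in> S - {p, q}" for z
  proof -
    have [simp]: "D z \<noteq> 0" using D0[OF that] .
    have Dd: "(D has_field_derivative (P * sinh (P * z))) (at z within S - {p, q})"
      unfolding D_def by (auto intro!: derivative_eq_intros)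
    \<comment> \<open>Inserting sinh^2 = (D - c)^2 - 1 into the numerator of the derivative of
      \<open>G\<close> leaves s^2 + c D plus the term from the exponential. The part s^2 / D^2 is
      the kernel; all the rest is divisible by \<open>D\<close> and forms \<open>h\<close>.\<close>
    have ch: "cosh (P * z) = D z - c" and Dz: "cosh (P * z) + c = D z" by (simp_all add: D_def)
    have sh: "sinh (P * z) * sinh (P * z) = (D z - c)\<^sup>2 - 1"
      using sinh_square_eq[of "P * z"] by (simp add: ch power2_eq_square)
    have "(G has_field_derivative
        (\<i> * K * exp (\<i> * K * z) * sinh (P * z) + exp (\<i> * K * z) * (P * cosh (P * z))) / (P * D z)
        - exp (\<i> * K * z) * sinh (P * z) * (P * (P * sinh (P * z))) / (P * D z)\<^sup>2) (at z within S - {p, q})"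
      unfolding G_def
      by (rule derivative_eq_intros Dd refl | simp)+ (simp add: field_simps power2_eq_square)
    moreover have "(\<i> * K * exp (\<i> * K * z) * sinh (P * z) + exp (\<i> * K * z) * (P * cosh (P * z))) / (P * D z)
        - exp (\<i> * K * z) * sinh (P * z) * (P * (P * sinh (P * z))) / (P * D z)\<^sup>2
       = exp (\<i> * K * z) * (\<i> * K * sinh (P * z) * D z / P + (D z - c) * D z - sinh (P * z) * sinh (P * z)) / (D z)\<^sup>2"
      by (simp add: ch field_simps power2_eq_square)
    moreover have "\<dots> = exp (\<i> * K * z) * (s\<^sup>2 + (\<i> * K * sinh (P * z) / P + c) * D z) / (D z)\<^sup>2"
      unfolding sh cs by (simp add: field_simps power2_eq_square)
    moreover have "\<dots> = A_kernel k y z + h z"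
      unfolding A_kernel_def h_def u_def s_def[symmetric] c_def[symmetric] P_def[symmetric] K_def[symmetric] Dz
      by (simp add: field_simps power2_eq_square)
    ultimately show ?thesis by simp
  qed
  \<comment> \<open>\<open>G\<close> is a primitive along a closed path that avoids the poles, so
    the integral of the kernel is minus that of \<open>h\<close>.\<close>
  have int0: "((\<lambda>z. A_kernel k y z + h z) has_contour_integral 0) ?\<gamma>"
    by (rule Cauchy_theorem_primitive[OF G']) (use path in auto)
  have holo: "u holomorphic_on T" "D holomorphic_on T" for T
    unfolding u_def D_def cosh_conv_cos sinh_conv_sin by (auto intro!: holomorphic_intros)
  have hh: "h holomorphic_on S - {p, q}"
    unfolding h_def by (intro holomorphic_intros holo D0)
  have shp: "sinh (P * p) = \<i> * s"
  proof -
    have "\<i> * (P * p) = - of_real (pi - pi * y)"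
      by (simp add: p_def P_def algebra_simps)
    then have "sin (\<i> * (P * p)) = - s"
      by (simp only: sin_minus sin_of_real) (simp add: s_def sin_diff)
    then show ?thesis by (simp add: sinh_conv_sin)
  qed
  have shq: "sinh (P * q) = - \<i> * s"
  proof -
    have "\<i> * (P * q) = - of_real (pi + pi * y)"
      by (simp add: q_def P_def algebra_simps)
    then have "sin (\<i> * (P * q)) = s"
      by (simp only: sin_minus sin_of_real) (simp add: s_def sin_add)
    then show ?thesis by (simp add: sinh_conv_sin)
  qed
  have Dp: "D p = 0"
  proof -
    have "\<i> * (P * p) = - of_real (pi - pi * y)"
      by (simp add: p_def P_def algebra_simps)
    then have "cos (\<i> * (P * p)) = - c"
      by (simp only: cos_minus cos_of_real) (simp add: c_def cos_diff)
    then show ?thesis by (simp add: D_def cosh_conv_cos)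
  qed
  have Dq: "D q = 0"
  proof -
    have "\<i> * (P * q) = - of_real (pi + pi * y)"
      by (simp add: q_def P_def algebra_simps)
    then have "cos (\<i> * (P * q)) = - c"
      by (simp only: cos_minus cos_of_real) (simp add: c_def cos_add)
    then show ?thesis by (simp add: D_def cosh_conv_cos)
  qed
  have s0: "s \<noteq> 0" using sin0 by (simp add: s_def)
  \<comment> \<open>The zeros of \<open>D\<close> are simple, because its derivative P sinh (P w) is
    i s P or - i s P there and \<open>s\<close> is nonzero.\<close>
  have res: "residue h w = u w / (P * sinh (P * w))"
    if w: "D w = 0" "w \<in> {p, q}" "sinh (P * w) \<noteq> 0" for w
  proof (rule residue_simple'[where s = "S - ({p, q} - {w})"])
    show "open (S - ({p, q} - {w}))" using S(1) by (intro open_Diff finite_imp_closed) auto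
    show "w \<in> S - ({p, q} - {w})" using w pq by auto
    show "h holomorphic_on S - ({p, q} - {w}) - {w}"
      by (rule holomorphic_on_subset[OF hh]) (use w in auto)
    have "(D has_field_derivative (P * sinh (P * w))) (at w)"
      unfolding D_def by (auto intro!: derivative_eq_intros)
    then have "((\<lambda>z. D z / (z - w)) \<longlongrightarrow> P * sinh (P * w)) (at w)"
      using w(1) by (simp add: has_field_derivative_iff)
    moreover have "(u \<longlongrightarrow> u w) (at w)"
      unfolding u_def by (intro tendsto_intros) simp
    ultimately have "((\<lambda>z. u z / (D z / (z - w))) \<longlongrightarrow> u w / (P * sinh (P * w))) (at w)"
      using w(3) by (intro tendsto_intros) auto
    then show "((\<lambda>z. h z * (z - w)) \<longlongrightarrow> u w / (P * sinh (P * w))) (at w)"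
      by (simp add: h_def)
  qed
  have wn: "winding_number ?\<gamma> p = 1" "winding_number ?\<gamma> q = 1"
    using y R by (auto intro!: winding_number_rectpath simp: p_def q_def in_box_complex_iff)
  have "contour_integral ?\<gamma> h = 2 * pi * \<i> * (\<Sum>w\<in>{p, q}. winding_number ?\<gamma> w * residue h w)"
  proof (rule Residue_theorem[OF S _ hh])
    show "\<forall>z. z \<notin> S \<longrightarrow> winding_number ?\<gamma> z = 0"
      using R by (auto intro!: winding_number_rectpath_outside simp: S_def in_cbox_complex_iff)
  qed (use path in auto)
  also have "(\<Sum>w\<in>{p, q}. winding_number ?\<gamma> w * residue h w) = u p / (P * (\<i> * s)) + u q / (P * (- \<i> * s))"
    using pq s0 by (simp add: wn wn[simplified] res Dp Dq shp shq)
  also have "2 * pi * \<i> * (u p / (P * (\<i> * s)) + u q / (P * (- \<i> * s))) = 2 * (u p - u q) / s"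
    using s0 by (simp add: P_def field_simps)
  also have "u p = exp (- (K * of_real (1 - y))) * (c - K * s / P)"
    unfolding u_def shp by (simp add: p_def field_simps)
  also have "u q = exp (- (K * of_real (1 + y))) * (c + K * s / P)"
    unfolding u_def shq by (simp add: q_def field_simps)
  also have "2 * (exp (- (K * of_real (1 - y))) * (c - K * s / P) - exp (- (K * of_real (1 + y))) * (c + K * s / P)) / s
    = of_real (2 * (exp (- (real k * (1 - y))) * (cos (pi * y) - real k * sin (pi * y) / pi)
        - exp (- (real k * (1 + y))) * (cos (pi * y) + real k * sin (pi * y) / pi)) / sin (pi * y))"
    by (simp add: K_def c_def s_def P_def exp_of_real[symmetric])
  also have "2 * (exp (- (real k * (1 - y))) * (cos (pi * y) - real k * sin (pi * y) / pi)
        - exp (- (real k * (1 + y))) * (cos (pi * y) + real k * sin (pi * y) / pi)) / sin (pi * y)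
    = - (4 * exp (- real k) * (real k / pi * cosh (real k * y) - sinh (real k * y) * cot (pi * y)))"
  proof -
    have e: "exp (- (real k * (1 - y))) = exp (- real k) * exp (real k * y)"
      "exp (- (real k * (1 + y))) = exp (- real k) * exp (- (real k * y))"
      by (simp_all add: exp_add[symmetric] algebra_simps)
    show ?thesis unfolding e using sin0
      by (simp add: cosh_field_def sinh_field_def cot_def field_simps)
  qed
  finally have ch: "contour_integral ?\<gamma> h = - of_real (4 * exp (- real k) * (real k / pi * cosh (real k * y) - sinh (real k * y) * cot (pi * y)))"
    by simp
  have "h contour_integrable_on ?\<gamma>"
    by (rule contour_integrable_holomorphic_simple[OF hh]) (use path S in \<open>auto intro!: open_Diff\<close>)
  from has_contour_integral_diff[OF int0 has_contour_integral_integral[OF this]] ch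
  show ?thesis by simp
qed

text \<open>The shift moves the argument of the cosine by 2 pi. Hence the top side of the rectangle
  reproduces the integral over the bottom side up to the factor exp (-2 k).\<close>

lemma A_kernel_periodic: "A_kernel k y (z + 2 * \<i>) = of_real (exp (- 2 * real k)) * A_kernel k y z"
proof -
  have "\<i> * (of_real pi * (z + 2 * \<i>)) = \<i> * (of_real pi * z) - 2 * of_real pi"
    by (simp add: algebra_simps)
  then have "cos (\<i> * (of_real pi * (z + 2 * \<i>))) = cos (\<i> * (of_real pi * z))"
    by (simp add: cos_diff)
  moreover have "exp (\<i> * of_nat k * (z + 2 * \<i>)) = of_real (exp (- 2 * real k)) * exp (\<i> * of_nat k * z)"
    by (simp add: exp_of_real[symmetric] exp_add[symmetric] algebra_simps)
  ultimately show ?thesis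
    by (simp add: A_kernel_def cosh_conv_cos)
qed

text \<open>Both poles lie on the imaginary axis strictly between the heights 0 and 2, so each side
  of the rectangle satisfies the condition on \<open>T\<close>.\<close>

lemma A_kernel_continuous_on:
  assumes y: "1/4 < y" "y < 3/4"
    and T: "\<And>z. z \<in> T \<Longrightarrow> 0 \<le> Im z \<and> Im z \<le> 2 \<and> (Re z \<noteq> 0 \<or> Im z \<in> {0, 2})"
  shows "continuous_on T (A_kernel k y)"
  unfolding A_kernel_def cosh_conv_cos
proof (intro continuous_intros ballI)
  fix z assume "z \<in> T"
  then show "(cos (\<i> * (of_real pi * z)) + of_real (cos (pi * y)))\<^sup>2 \<noteq> 0"
    using cosh_plus_cos_eq_0[OF y, of z] T[of z] y by (auto simp: cosh_conv_cos)
qed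

text \<open>The squared norm equals sinh^2 (Re z) + cos^2 (Im z).\<close>

lemma norm_cosh_ge: "\<bar>sinh (Re z)\<bar> \<le> norm (cosh (z :: complex))"
proof -
  have eq: "cosh z = Complex (cosh (Re z) * cos (Im z)) (sinh (Re z) * sin (Im z))"
    by (simp add: complex_eq_iff cosh_field_def sinh_field_def Re_exp Im_exp field_simps)
  have "(sinh (Re z))\<^sup>2 \<le> (sinh (Re z))\<^sup>2 + (cos (Im z))\<^sup>2" by simp
  also have "\<dots> = (cosh (Re z) * cos (Im z))\<^sup>2 + (sinh (Re z) * sin (Im z))\<^sup>2"
    unfolding power_mult_distrib cosh_square_eq sin_squared_eq by (simp add: algebra_simps)
  finally have "sqrt ((sinh (Re z))\<^sup>2) \<le> norm (cosh z)"
    unfolding eq complex_norm by (simp only: real_sqrt_le_iff complex.sel)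
  then show ?thesis by simp
qed

text \<open>Makes the vertical sides negligible: the exponential has norm at most 1 in the upper
  half-plane, and the reverse triangle inequality bounds the denominator from below.\<close>

lemma norm_A_kernel_le:
  assumes "0 \<le> Im z" "1 < \<bar>sinh (pi * Re z)\<bar>"
  shows "norm (A_kernel k y z) \<le> 1 / (\<bar>sinh (pi * Re z)\<bar> - 1)\<^sup>2"
proof -
  have "\<bar>sinh (pi * Re z)\<bar> \<le> norm (cosh (of_real pi * z))"
    using norm_cosh_ge[of "of_real pi * z"] by simp
  also have "\<dots> \<le> norm (cosh (of_real pi * z) + of_real (cos (pi * y))) + norm (complex_of_real (cos (pi * y)))"
    by (metis add_diff_cancel_right' norm_triangle_ineq4)
  also have "norm (complex_of_real (cos (pi * y))) \<le> 1"
    by (simp only: norm_of_real) simp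
  finally have D: "\<bar>sinh (pi * Re z)\<bar> - 1 \<le> norm (cosh (of_real pi * z) + of_real (cos (pi * y)))"
    by simp
  have "norm (exp (\<i> * of_nat k * z) * (of_real (sin (pi * y)))\<^sup>2) \<le> 1 * 1"
    unfolding norm_mult norm_power norm_of_real using assms(1)
    by (intro mult_mono) (auto simp: abs_square_le_1)
  then show ?thesis
    unfolding A_kernel_def norm_divide using assms(2) D
    by (intro frac_le) (auto simp: norm_power intro!: power_mono)
qed

text \<open>Averaging the quadratic Taylor bound at |x| with the tangent bound at -|x| cancels the
  linear terms.\<close>

lemma cosh_ge_quadratic: "1 + x\<^sup>2 / 4 \<le> cosh (x::real)"
proof -
  have "1 + \<bar>x\<bar> + \<bar>x\<bar>\<^sup>2 / 2 \<le> exp \<bar>x\<bar>" by (rule exp_lower_Taylor_quadratic) simp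
  moreover have "1 + - \<bar>x\<bar> \<le> exp (- \<bar>x\<bar>)" by (rule exp_ge_add_one_self)
  ultimately have "1 + x\<^sup>2 / 4 \<le> cosh \<bar>x\<bar>" by (simp add: cosh_field_def)
  then show ?thesis by simp
qed

lemma integrable_A_integrand:
  fixes k :: nat
  assumes y: "0 < y" "y < 1"
  shows "integrable lborel (\<lambda>s. cos (real k * s) * (sin (pi * y) / (cosh (pi * s) + cos (pi * y)))\<^sup>2)"
proof -
  \<comment> \<open>1 + cos (pi y) is positive but may be below 1; the minimum is a factor that
    works for the constant term and for s^2 in the lower bound m (1 + s^2) of the
    denominator.\<close>
  define m where "m = min 1 (1 + cos (pi * y))"
  have "cos pi < cos (pi * y)"
    using y by (intro cos_monotone_0_pi) auto
  then have m: "0 < m" "m \<le> 1" "m \<le> 1 + cos (pi * y)" by (auto simp: m_def)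
  have D: "m * (1 + s\<^sup>2) \<le> cosh (pi * s) + cos (pi * y)" for s
  proof -
    have "1 * s\<^sup>2 \<le> (pi / 2)\<^sup>2 * s\<^sup>2"
      by (intro mult_right_mono) (use pi_ge_two in auto)
    also have "1 + (pi / 2)\<^sup>2 * s\<^sup>2 \<le> cosh (pi * s)"
      using cosh_ge_quadratic[of "pi * s"] by (simp add: power_mult_distrib power_divide)
    finally have "1 + s\<^sup>2 \<le> cosh (pi * s)" by simp
    moreover have "m * s\<^sup>2 \<le> 1 * s\<^sup>2" by (intro mult_right_mono m) simp
    ultimately show ?thesis using m(3) by (simp add: algebra_simps)
  qed
  have "integrable lborel (\<lambda>x::real. inverse (1 + x\<^sup>2))"
    using integrable_inverse_1_plus_square by (simp add: set_integrable_def einterval_def)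
  moreover have [measurable]: "(\<lambda>s. cosh (pi * s)) \<in> borel_measurable borel"
    by (intro borel_measurable_continuous_onI continuous_intros)
  ultimately have "integrable lborel (\<lambda>s. 1 / m\<^sup>2 * inverse (1 + s\<^sup>2))" by simp
  then show ?thesis
  proof (rule Bochner_Integration.integrable_bound)
    show "AE s in lborel. norm (cos (real k * s) * (sin (pi * y) / (cosh (pi * s) + cos (pi * y)))\<^sup>2)
        \<le> norm (1 / m\<^sup>2 * inverse (1 + s\<^sup>2))"
    proof (intro AE_I2)
      fix s :: real
      have pos: "0 < m * (1 + s\<^sup>2)" using m(1) by (auto intro!: mult_pos_pos add_pos_nonneg)
      have "norm (cos (real k * s) * (sin (pi * y) / (cosh (pi * s) + cos (pi * y)))\<^sup>2)
          \<le> 1 * (1 / (m * (1 + s\<^sup>2)))\<^sup>2"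
        unfolding norm_mult norm_power norm_divide using D[of s] pos
        by (intro mult_mono power_mono frac_le) auto
      also have "\<dots> = 1 / m\<^sup>2 * (1 / (1 + s\<^sup>2) * (1 / (1 + s\<^sup>2)))"
        by (simp add: power2_eq_square)
      also have "\<dots> \<le> 1 / m\<^sup>2 * (1 / (1 + s\<^sup>2) * 1)"
        by (intro mult_left_mono) (auto simp: field_simps add_pos_nonneg)
      finally show "norm (cos (real k * s) * (sin (pi * y) / (cosh (pi * s) + cos (pi * y)))\<^sup>2)
        \<le> norm (1 / m\<^sup>2 * inverse (1 + s\<^sup>2))" by (simp add: inverse_eq_divide)
    qed
  qed measurable
qed

text \<open>The top side is \<open>q\<close> times the bottom side and runs backwards, the vertical
  sides vanish as \<open>R\<close> grows, and the residues contribute \<open>V\<close>. In the limit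
  (1 - q) times the integral of \<open>g\<close> equals \<open>V\<close>, and \<open>k\<close> being
  positive gives q < 1.\<close>

lemma A_eq_B:
  assumes y: "1/4 < y" "y < 3/4" and k: "1 \<le> k"
  shows "A k y = B k y"
proof -
  define g where "g = (\<lambda>s. cos (real k * s) * (sin (pi * y) / (cosh (pi * s) + cos (pi * y)))\<^sup>2)"
  define V where "V = 4 * exp (- real k) * (real k / pi * cosh (real k * y) - sinh (real k * y) * cot (pi * y))"
  define q where "q = exp (- 2 * real k)"
  have g_int: "integrable lborel g"
    unfolding g_def by (rule integrable_A_integrand) (use y in auto)
  have A_kernel_g: "Re (A_kernel k y (of_real s)) = g s" for s
  proof -
    have "A_kernel k y (of_real s) = exp (\<i> * of_real (k * s)) * of_real ((sin (pi * y) / (cosh (pi * s) + cos (pi * y)))\<^sup>2)"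
      by (simp add: A_kernel_def power_divide cosh_field_def exp_of_real[symmetric] mult.assoc)
    then show ?thesis
      by (simp only: Re_complex_of_real Im_complex_of_real times_complex.sel)
        (simp add: g_def Re_exp)
  qed
  have approx: "\<bar>(1 - q) * integral {-R..R} g - V\<bar> \<le> 4 / (sinh (pi * R) - 1)\<^sup>2" if R: "0 < R" "1 < sinh (pi * R)" for R
  proof -
    define a1 a2 a3 a4 where "a1 = complex_of_real (- R)" and "a2 = complex_of_real R"
      and "a3 = of_real R + 2 * \<i>" and "a4 = of_real (- R) + 2 * \<i>"
    let ?I = "\<lambda>a b. contour_integral (linepath a b) (A_kernel k y)"
    have cont: "A_kernel k y contour_integrable_on linepath a b"
      if "(a, b) \<in> {(a1, a2), (a2, a3), (a3, a4), (a4, a1), (a4, a3)}" for a b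
      using that R
      by (intro contour_integrable_continuous_linepath A_kernel_continuous_on[OF y])
        (auto simp: a1_def a2_def a3_def a4_def closed_segment_same_Re closed_segment_same_Im
          closed_segment_eq_real_ivl)
    have rp: "rectpath a1 a3 = linepath a1 a2 +++ linepath a2 a3 +++ linepath a3 a4 +++ linepath a4 a1"
      unfolding rectpath_def Let_def
      by (intro arg_cong2[where f = "(+++)"] arg_cong2[where f = linepath])
        (auto simp: a1_def a2_def a3_def a4_def complex_eq_iff)
    have "contour_integral (rectpath a1 a3) (A_kernel k y) = of_real V"
      using contour_integral_unique[OF A_kernel_rect[OF y R(1), of k]] by (simp add: a1_def a3_def V_def)
    then have sum: "?I a1 a2 + (?I a2 a3 + (?I a3 a4 + ?I a4 a1)) = of_real V"
      unfolding rp using cont by (simp add: contour_integrable_joinI)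
    have "?I a4 a3 = of_real q * ?I a1 a2"
    proof (rule contour_integral_unique)
      have "((\<lambda>z. of_real q * A_kernel k y z) has_contour_integral of_real q * ?I a1 a2) (linepath a1 a2)"
        using cont by (intro has_contour_integral_lmul has_contour_integral_integral) auto
      moreover have "linepath a4 a3 x = linepath a1 a2 x + 2 * \<i>" for x
        by (simp add: linepath_def a1_def a2_def a3_def a4_def scaleR_conv_of_real algebra_simps)
      moreover have "a3 - a4 = a2 - a1" by (simp add: a1_def a2_def a3_def a4_def)
      ultimately show "(A_kernel k y has_contour_integral of_real q * ?I a1 a2) (linepath a4 a3)"
        by (simp add: has_contour_integral_linepath A_kernel_periodic q_def)
    qed
    moreover have "?I a3 a4 = - ?I a4 a3"
      by (rule contour_integral_reverse_linepath)
        (use R in \<open>auto intro!: A_kernel_continuous_on[OF y] simp: a1_def a2_def a3_def a4_def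
          closed_segment_same_Re closed_segment_same_Im closed_segment_eq_real_ivl\<close>)
    ultimately have eq: "(1 - of_real q) * ?I a1 a2 - of_real V = - (?I a2 a3 + ?I a4 a1)"
      using sum by (simp add: algebra_simps)
    have vert: "norm (?I a b) \<le> 1 / (sinh (pi * R) - 1)\<^sup>2 * norm (b - a)"
      if "(a, b) \<in> {(a2, a3), (a4, a1)}" for a b
    proof (rule contour_integral_bound_linepath)
      fix z assume "z \<in> closed_segment a b"
      then have "\<bar>Re z\<bar> = R" "0 \<le> Im z"
        using that R by (auto simp: a1_def a2_def a3_def a4_def closed_segment_same_Re closed_segment_eq_real_ivl)
      moreover from \<open>\<bar>Re z\<bar> = R\<close> have "Re z = R \<or> Re z = - R" by linarith
      then have "\<bar>sinh (pi * Re z)\<bar> = sinh (pi * R)"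
        using R(2) by auto
      ultimately show "norm (A_kernel k y z) \<le> 1 / (sinh (pi * R) - 1)\<^sup>2"
        using norm_A_kernel_le[of z k y] R by simp
    qed (use that cont in auto)
    \<comment> \<open>Each vertical side has length 2, which produces the constant 4 in
      \<open>approx\<close>.\<close>
    have "norm (?I a2 a3 + ?I a4 a1) \<le> 1 / (sinh (pi * R) - 1)\<^sup>2 * 2 + 1 / (sinh (pi * R) - 1)\<^sup>2 * 2"
      using vert[of a2 a3] vert[of a4 a1]
      by (intro norm_triangle_le add_mono) (auto simp: a1_def a2_def a3_def a4_def norm_mult)
    then have le: "norm ((1 - of_real q) * ?I a1 a2 - of_real V) \<le> 4 / (sinh (pi * R) - 1)\<^sup>2"
      unfolding eq norm_minus_cancel by simp
    have "((\<lambda>s. A_kernel k y (of_real s)) has_integral ?I a1 a2) {-R..R}"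
      using has_contour_integral_linepath_Reals_iff[of a1 a2 "A_kernel k y" "?I a1 a2"] R cont[of a1 a2]
      by (simp add: a1_def a2_def has_contour_integral_integral)
    from has_integral_Re[OF this] have "Re (?I a1 a2) = integral {-R..R} g"
      by (simp add: A_kernel_g integral_unique)
    then have "(1 - q) * integral {-R..R} g - V = Re ((1 - of_real q) * ?I a1 a2 - of_real V)"
      by simp
    also have "\<bar>\<dots>\<bar> \<le> 4 / (sinh (pi * R) - 1)\<^sup>2"
      using le abs_Re_le_cmod order_trans by blast
    finally show ?thesis .
  qed
  have "((\<lambda>R. \<integral>s. indicator {-R..R} s *\<^sub>R g s \<partial>lborel) \<longlongrightarrow> (\<integral>s. g s \<partial>lborel)) at_top"
  proof (rule integral_dominated_convergence_at_top[where w = "\<lambda>s. \<bar>g s\<bar>"])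
    show "AE x in lborel. ((\<lambda>R. indicator {-R..R} x *\<^sub>R g x) \<longlongrightarrow> g x) at_top"
    proof (intro AE_I2 tendsto_eventually)
      fix x :: real
      show "\<forall>\<^sub>F R in at_top. indicator {-R..R} x *\<^sub>R g x = g x"
        using eventually_ge_at_top[of "\<bar>x\<bar>"]
        by eventually_elim (auto simp: indicator_def abs_le_iff)
    qed
    show "\<forall>\<^sub>F R in at_top. AE x in lborel. norm (indicator {-R..R} x *\<^sub>R g x) \<le> \<bar>g x\<bar>"
      by (auto split: split_indicator)
  qed (use g_int in auto)
  moreover have "(\<integral>s. indicator {-R..R} s *\<^sub>R g s \<partial>lborel) = integral {-R..R} g" for R
    using set_borel_integral_eq_integral(2)[of "{-R..R}" g] integrable_mult_indicator[of "{-R..R}" lborel g] g_int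
    by (simp add: set_integrable_def set_lebesgue_integral_def)
  ultimately have lim: "((\<lambda>R. (1 - q) * integral {-R..R} g - V) \<longlongrightarrow> (1 - q) * (\<integral>s. g s \<partial>lborel) - V) at_top"
    by (auto intro!: tendsto_intros)
  have "((\<lambda>R. (1 - q) * integral {-R..R} g - V) \<longlongrightarrow> 0) at_top"
  proof (rule Lim_null_comparison)
    have inf: "filterlim (\<lambda>R. sinh (pi * R)) at_top at_top" by real_asymp
    show "\<forall>\<^sub>F R in at_top. norm ((1 - q) * integral {-R..R} g - V) \<le> 4 / (sinh (pi * R) - 1)\<^sup>2"
      using eventually_gt_at_top[of 0] filterlim_at_top_dense[THEN iffD1, OF inf, rule_format, of 1]
      by eventually_elim (use approx in simp)
    show "((\<lambda>R. 4 / (sinh (pi * R) - 1)\<^sup>2) \<longlongrightarrow> 0) at_top" by real_asymp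
  qed
  with lim have "(1 - q) * (\<integral>s. g s \<partial>lborel) = V"
    using tendsto_unique[OF _ lim] by fastforce
  moreover have "A k y = (\<integral>s. g s \<partial>lborel) / 4"
  proof -
    have "A k y = (\<integral>s. g s / 4 \<partial>lborel)"
      unfolding A_def g_def power_mult_distrib by (simp add: power_one_over mult.left_commute)
    then show ?thesis by simp
  qed
  moreover have "q < 1" using k by (simp add: q_def)
  ultimately have "A k y = V / (4 * (1 - q))" by (simp add: field_simps)
  also have "\<dots> = B k y"
  proof -
    \<comment> \<open>The identity 1 - exp (-2 k) = 2 exp (-k) sinh k cancels the prefactor of
      \<open>V\<close>.\<close>
    have "4 * (1 - q) = 4 * exp (- real k) * (2 * sinh (real k))"
      by (simp add: sinh_field_def q_def algebra_simps exp_add[symmetric])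
    moreover have "4 * exp (- real k) * w / (4 * exp (- real k) * v) = 1 / v * w" for v w :: real
      by simp
    ultimately show ?thesis unfolding V_def B_def by (simp only:)
  qed
  finally show ?thesis .
qed

subsection \<open>Derivatives of the approximate Robin function\<close>

definition B' :: "nat \<Rightarrow> real \<Rightarrow> real" where
  "B' k y = 1 / (2 * sinh (real k)) *
     ((real k)\<^sup>2 / pi * sinh (real k * y) - real k * cosh (real k * y) * cot (pi * y)
      + pi * sinh (real k * y) / (sin (pi * y))\<^sup>2)"

definition B'' :: "nat \<Rightarrow> real \<Rightarrow> real" where
  "B'' k y = 1 / (2 * sinh (real k)) *
     ((real k)^3 / pi * cosh (real k * y) - (real k)\<^sup>2 * sinh (real k * y) * cot (pi * y)
      + 2 * real k * pi * cosh (real k * y) / (sin (pi * y))\<^sup>2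
      - 2 * pi\<^sup>2 * sinh (real k * y) * cos (pi * y) / (sin (pi * y))^3)"

lemma sin_pi_mult_pos: "0 < y \<Longrightarrow> y < 1 \<Longrightarrow> 0 < sin (pi * y)"
  by (intro sin_gt_zero) (auto simp: mult.commute)

lemma DERIV_cot_pi:
  assumes "0 < y" "y < 1"
  shows "((\<lambda>y. cot (pi * y)) has_real_derivative - (pi / (sin (pi * y))\<^sup>2)) (at y)"
proof -
  have "((\<lambda>y. cot (pi * y)) has_real_derivative - inverse ((sin (pi * y))\<^sup>2) * pi) (at y)"
    by (rule DERIV_chain2[OF DERIV_cot]) (use sin_pi_mult_pos[OF assms] in \<open>auto intro!: derivative_eq_intros\<close>)
  then show ?thesis by (simp add: field_simps)
qed

lemma DERIV_B:
  assumes "0 < y" "y < 1"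
  shows "(B k has_real_derivative B' k y) (at y)"
  unfolding B_def[abs_def] B'_def
  by (rule DERIV_cmult, (rule derivative_eq_intros DERIV_cot_pi assms refl)+)
    (simp add: field_simps power2_eq_square)

lemma DERIV_B':
  assumes "0 < y" "y < 1"
  shows "(B' k has_real_derivative B'' k y) (at y)"
proof -
  have "((\<lambda>y. pi * sinh (real k * y) / (sin (pi * y))\<^sup>2) has_real_derivative
      real k * pi * cosh (real k * y) / (sin (pi * y))\<^sup>2
      - 2 * pi\<^sup>2 * sinh (real k * y) * cos (pi * y) / (sin (pi * y))^3) (at y)"
    using sin_pi_mult_pos[OF assms]
    by (auto intro!: derivative_eq_intros simp: divide_simps power2_eq_square power3_eq_cube)
      (simp add: algebra_simps)
  note D = this
  show ?thesis
    unfolding B'_def[abs_def] B''_def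
    by (rule DERIV_cmult, (rule derivative_eq_intros DERIV_cot_pi D assms refl)+)
      (simp add: algebra_simps power2_eq_square power3_eq_cube)
qed

lemma isCont_B'': "0 < y \<Longrightarrow> y < 1 \<Longrightarrow> isCont (B'' k) y"
  unfolding B''_def[abs_def] using sin_pi_mult_pos[of y]
  by (intro continuous_intros) (auto intro!: DERIV_isCont[OF DERIV_cot_pi])

section \<open>Values of the coefficients on the centerline\<close>

lemma sinh_real_double: "sinh (real k) = 2 * sinh (real k / 2) * cosh (real k / 2)"
  using sinh_double[of "real k / 2"] by simp

lemma B_half: "1 \<le> k \<Longrightarrow> B k (1/2) = real k / (4 * pi * sinh (real k / 2))"
  unfolding B_def sinh_real_double by (simp add: cot_def field_simps)

text \<open>At 1/2 the cotangent vanishes and the sine is 1; halving the argument of sinh k cancels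
  sinh (k / 2). This is the origin of the constants (k^2 + pi^2) / cosh (k / 2) in
  \<open>Yshift\<close>.\<close>

lemma B'_half:
  assumes "1 \<le> k"
  shows "B' k (1/2) = ((real k)\<^sup>2 + pi\<^sup>2) / (4 * pi * cosh (real k / 2))"
proof -
  have "sinh (real k / 2) \<noteq> 0" using assms by simp
  then show ?thesis
    unfolding B'_def sinh_real_double by (simp add: cot_def field_simps power2_eq_square)
qed

text \<open>
  Partial derivatives of the coefficient \<open>B 1 y cos x + a B n y cos (n x)\<close> of \<open>\<epsilon>\<close> in \<open>R_approx n a \<epsilon>\<close>.
\<close>

definition gx :: "nat \<Rightarrow> real \<Rightarrow> real \<Rightarrow> real \<Rightarrow> real" where
  "gx n a x y = - (B 1 y * sin x + a * real n * B n y * sin (real n * x))"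

definition gy :: "nat \<Rightarrow> real \<Rightarrow> real \<Rightarrow> real \<Rightarrow> real" where
  "gy n a x y = B' 1 y * cos x + a * B' n y * cos (real n * x)"

definition gxx :: "nat \<Rightarrow> real \<Rightarrow> real \<Rightarrow> real \<Rightarrow> real" where
  "gxx n a x y = - (B 1 y * cos x + a * (real n)\<^sup>2 * B n y * cos (real n * x))"

definition gxy :: "nat \<Rightarrow> real \<Rightarrow> real \<Rightarrow> real \<Rightarrow> real" where
  "gxy n a x y = - (B' 1 y * sin x + a * real n * B' n y * sin (real n * x))"

definition gyy :: "nat \<Rightarrow> real \<Rightarrow> real \<Rightarrow> real \<Rightarrow> real" where
  "gyy n a x y = B'' 1 y * cos x + a * B'' n y * cos (real n * x)"

lemma DERIV_gx:
  assumes "0 < y" "y < 1"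
  shows "((\<lambda>x. gx n a x y) has_real_derivative gxx n a x y) (at x)"
    and "((\<lambda>y. gx n a x y) has_real_derivative gxy n a x y) (at y)"
  unfolding gx_def gxx_def gxy_def
  by (auto intro!: derivative_eq_intros DERIV_B assms simp: algebra_simps power2_eq_square)

lemma DERIV_gy:
  assumes "0 < y" "y < 1"
  shows "((\<lambda>x. gy n a x y) has_real_derivative gxy n a x y) (at x)"
    and "((\<lambda>y. gy n a x y) has_real_derivative gyy n a x y) (at y)"
  unfolding gy_def gyy_def gxy_def
  by (auto intro!: derivative_eq_intros DERIV_B' assms simp: algebra_simps)

lemma has_derivative_gx:
  assumes "0 < y" "y < 1"
  shows "((\<lambda>p. gx n a (fst p) (snd p)) has_derivative
           (\<lambda>h. gxx n a x y * fst h + gxy n a x y * snd h)) (at (x, y))"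
proof -
  have B: "((\<lambda>p. B k (snd p)) has_derivative (\<lambda>h. snd h * B' k y)) (at (x, y))" for k
    by (rule DERIV_compose_FDERIV) (auto intro!: DERIV_B assms derivative_eq_intros)
  show ?thesis unfolding gx_def gxx_def gxy_def
    by (rule derivative_eq_intros B refl)+ (auto simp: algebra_simps power2_eq_square)
qed

lemma has_derivative_gy:
  assumes "0 < y" "y < 1"
  shows "((\<lambda>p. gy n a (fst p) (snd p)) has_derivative
           (\<lambda>h. gxy n a x y * fst h + gyy n a x y * snd h)) (at (x, y))"
proof -
  have B: "((\<lambda>p. B' k (snd p)) has_derivative (\<lambda>h. snd h * B'' k y)) (at (x, y))" for k
    by (rule DERIV_compose_FDERIV) (auto intro!: DERIV_B' assms derivative_eq_intros)
  show ?thesis unfolding gy_def gyy_def gxy_def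
    by (rule derivative_eq_intros B refl)+ (auto simp: algebra_simps)
qed

section \<open>Gradient, Hessian and isolation of critical points\<close>

lemma DERIV_R0:
  assumes "0 < y" "y < 1"
  shows "(R0 has_real_derivative cot (pi * y) / 2) (at y)"
  unfolding R0_def[abs_def] using sin_pi_mult_pos[OF assms]
  by (auto intro!: derivative_eq_intros simp: cot_def field_simps)

lemma R_approx_eq:
  assumes "1 \<le> n" "1/4 < y" "y < 3/4"
  shows "R_approx n a \<epsilon> (x, y) = R0 y + \<epsilon> * B 1 y * cos x + \<epsilon> * a * B n y * cos (real n * x)"
  using assms by (simp add: R_approx_def A_eq_B)

lemma has_derivative_R_approx:
  assumes n: "1 \<le> n" and y: "1/4 < y" "y < 3/4"
  shows "(R_approx n a \<epsilon> has_derivative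
           (\<lambda>h. \<epsilon> * gx n a x y * fst h + (cot (pi * y) / 2 + \<epsilon> * gy n a x y) * snd h)) (at (x, y))"
proof (rule has_derivative_transform_within_open)
  have B: "((\<lambda>p. B k (snd p)) has_derivative (\<lambda>h. snd h * B' k y)) (at (x, y))" for k
    by (rule DERIV_compose_FDERIV) (use y in \<open>auto intro!: DERIV_B derivative_eq_intros\<close>)
  have R: "((\<lambda>p. R0 (snd p)) has_derivative (\<lambda>h. snd h * (cot (pi * y) / 2))) (at (x, y))"
    by (rule DERIV_compose_FDERIV) (use y in \<open>auto intro!: DERIV_R0 derivative_eq_intros\<close>)
  show "((\<lambda>p. R0 (snd p) + \<epsilon> * B 1 (snd p) * cos (fst p) + \<epsilon> * a * B n (snd p) * cos (real n * fst p))
      has_derivative (\<lambda>h. \<epsilon> * gx n a x y * fst h + (cot (pi * y) / 2 + \<epsilon> * gy n a x y) * snd h)) (at (x, y))"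
    unfolding gx_def gy_def
    by (rule derivative_eq_intros B R refl)+ (auto simp: algebra_simps)
  show "open (UNIV \<times> {1/4<..<3/4::real} :: (real \<times> real) set)"
    by (intro open_Times) auto
qed (use R_approx_eq[OF n] y in auto)

lemma critical_points_iff:
  assumes n: "1 \<le> n" and \<delta>: "\<delta> \<le> 1/4" and \<epsilon>: "\<epsilon> \<noteq> 0"
  shows "(x, y) \<in> critical_points (R_approx n a \<epsilon>) (midstrip \<delta>) \<longleftrightarrow>
    \<bar>y - 1/2\<bar> < \<delta> \<and> gx n a x y = 0 \<and> cot (pi * y) / 2 + \<epsilon> * gy n a x y = 0"
proof (cases "\<bar>y - 1/2\<bar> < \<delta>")
  case True
  then have y: "1/4 < y" "y < 3/4" using \<delta> by linarith+
  note D = has_derivative_R_approx[OF n y, of a \<epsilon> x]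
  have "(R_approx n a \<epsilon> has_derivative (\<lambda>_. 0)) (at (x, y)) \<longleftrightarrow>
      (\<lambda>h. \<epsilon> * gx n a x y * fst h + (cot (pi * y) / 2 + \<epsilon> * gy n a x y) * snd h) = (\<lambda>_. 0)"
    using D has_derivative_unique[OF D] by metis
  also have "\<dots> \<longleftrightarrow> gx n a x y = 0 \<and> cot (pi * y) / 2 + \<epsilon> * gy n a x y = 0"
  proof
    assume eq: "(\<lambda>h. \<epsilon> * gx n a x y * fst h + (cot (pi * y) / 2 + \<epsilon> * gy n a x y) * snd h) = (\<lambda>_. 0)"
    show "gx n a x y = 0 \<and> cot (pi * y) / 2 + \<epsilon> * gy n a x y = 0"
      using fun_cong[OF eq, of "(1, 0)"] fun_cong[OF eq, of "(0, 1)"] \<epsilon> by simp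
  qed auto
  finally show ?thesis
    using True by (auto simp: critical_points_def midstrip_def abs_less_iff)
next
  case False
  then show ?thesis by (auto simp: critical_points_def midstrip_def abs_less_iff)
qed

lemma hessian_R_approx:
  assumes n: "1 \<le> n" and y: "1/4 < y" "y < 3/4"
  shows "hessian (R_approx n a \<epsilon>) (x, y) = vector
     [vector [\<epsilon> * gxx n a x y, \<epsilon> * gxy n a x y],
      vector [\<epsilon> * gxy n a x y, - pi / (2 * (sin (pi * y))\<^sup>2) + \<epsilon> * gyy n a x y]]"
proof -
  have px: "partial_x (R_approx n a \<epsilon>) (u, v) = \<epsilon> * gx n a u v" if "1/4 < v" "v < 3/4" for u v
  proof -
    have "((\<lambda>t. R_approx n a \<epsilon> (t, v)) has_derivative (\<lambda>h. \<epsilon> * gx n a u v * h)) (at u)"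
    proof -
      have "((\<lambda>t. (t, v)) has_derivative (\<lambda>h. (h, 0))) (at u)"
        by (intro has_derivative_Pair has_derivative_ident has_derivative_const)
      from has_derivative_in_compose[OF this has_derivative_at_withinI[OF has_derivative_R_approx[OF n that]]]
      show ?thesis by simp
    qed
    then show ?thesis
      unfolding partial_x_def by (simp add: DERIV_imp_deriv has_field_derivative_def)
  qed
  have py: "partial_y (R_approx n a \<epsilon>) (u, v) = cot (pi * v) / 2 + \<epsilon> * gy n a u v" if "1/4 < v" "v < 3/4" for u v
  proof -
    have "((\<lambda>t. R_approx n a \<epsilon> (u, t)) has_derivative (\<lambda>h. (cot (pi * v) / 2 + \<epsilon> * gy n a u v) * h)) (at v)"
    proof -
      have "((\<lambda>t. (u, t)) has_derivative (\<lambda>h. (0, h))) (at v)"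
        by (intro has_derivative_Pair has_derivative_ident has_derivative_const)
      from has_derivative_in_compose[OF this has_derivative_at_withinI[OF has_derivative_R_approx[OF n that]]]
      show ?thesis by simp
    qed
    then show ?thesis
      unfolding partial_y_def by (simp add: DERIV_imp_deriv has_field_derivative_def)
  qed
  \<comment> \<open>An outer derivative in \<open>y\<close> requires the first partials on a whole
    neighbourhood of the height; an outer derivative in \<open>x\<close> keeps the height
    fixed.\<close>
  have ev: "\<forall>\<^sub>F t in nhds y. 1/4 < t \<and> t < 3/4"
    using y eventually_nhds_in_open[of "{1/4<..<3/4}" y] by simp
  have y01: "0 < y" "y < 1" using y by linarith+
  have 1: "partial_x (partial_x (R_approx n a \<epsilon>)) (x, y) = \<epsilon> * gxx n a x y"
    unfolding partial_x_def[of "partial_x _"] using px[OF y]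
    by (auto intro!: DERIV_imp_deriv DERIV_cmult DERIV_gx y01)
  have 2: "partial_y (partial_x (R_approx n a \<epsilon>)) (x, y) = \<epsilon> * gxy n a x y"
  proof -
    have "deriv (\<lambda>t. partial_x (R_approx n a \<epsilon>) (x, t)) y = deriv (\<lambda>t. \<epsilon> * gx n a x t) y"
      by (rule deriv_cong_ev[OF _ refl]) (use ev px in \<open>auto elim!: eventually_mono\<close>)
    then show ?thesis
      unfolding partial_y_def by (auto intro!: DERIV_imp_deriv DERIV_cmult DERIV_gx y01)
  qed
  have 3: "partial_x (partial_y (R_approx n a \<epsilon>)) (x, y) = \<epsilon> * gxy n a x y"
    unfolding partial_x_def using py[OF y]
    by (auto intro!: DERIV_imp_deriv derivative_eq_intros DERIV_gy y01)
  have 4: "partial_y (partial_y (R_approx n a \<epsilon>)) (x, y) = - pi / (2 * (sin (pi * y))\<^sup>2) + \<epsilon> * gyy n a x y"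
  proof -
    have "deriv (\<lambda>t. partial_y (R_approx n a \<epsilon>) (x, t)) y = deriv (\<lambda>t. cot (pi * t) / 2 + \<epsilon> * gy n a x t) y"
      by (rule deriv_cong_ev[OF _ refl]) (use ev py in \<open>auto elim!: eventually_mono\<close>)
    also have "\<dots> = - (pi / (sin (pi * y))\<^sup>2) / 2 + \<epsilon> * gyy n a x y"
      by (intro DERIV_imp_deriv DERIV_add DERIV_cdivide DERIV_cmult DERIV_gy DERIV_cot_pi y01)
    finally show ?thesis
      unfolding partial_y_def[of "partial_y _"] by (simp add: mult.commute)
  qed
  show ?thesis unfolding hessian_def 1 2 3 4 by simp
qed

text \<open>
  The Hessian determinant of \<open>R_approx n a \<epsilon>\<close> divided by \<open>\<epsilon>\<close>, so that it stays away from \<open>0\<close> as \<open>\<epsilon> \<rightarrow> 0\<close>.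
\<close>

definition Jac :: "nat \<Rightarrow> real \<Rightarrow> real \<Rightarrow> real \<Rightarrow> real \<Rightarrow> real" where
  "Jac n a \<epsilon> x y = gxx n a x y * (- pi / (2 * (sin (pi * y))\<^sup>2) + \<epsilon> * gyy n a x y) - \<epsilon> * (gxy n a x y)\<^sup>2"

lemma nondegenerate_at_R_approx:
  assumes "1 \<le> n" "1/4 < y" "y < 3/4" "\<epsilon> \<noteq> 0" "Jac n a \<epsilon> x y \<noteq> 0"
  shows "nondegenerate_at (R_approx n a \<epsilon>) (x, y)"
proof -
  have "det (hessian (R_approx n a \<epsilon>) (x, y)) = \<epsilon> * Jac n a \<epsilon> x y"
    unfolding hessian_R_approx[OF assms(1-3)] det_2 Jac_def by (simp add: algebra_simps power2_eq_square)
  then show ?thesis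
    unfolding nondegenerate_at_def invertible_det_nz using assms by simp
qed

text \<open>An injective derivative expands norms by at least some \<open>b\<close> > 0. Near
  \<open>p\<close> the linearization error is at most half of that, so a second zero would give b |q
  - p| <= (b / 2) |q - p|.\<close>

lemma isolated_zero:
  fixes F :: "'a::real_normed_vector \<Rightarrow> 'b::euclidean_space"
  assumes F: "(F has_derivative F') (at p)" and inj: "inj F'" and 0: "F p = 0"
  obtains e where "0 < e" "\<And>q. dist p q < e \<Longrightarrow> F q = 0 \<Longrightarrow> q = p"
proof -
  obtain b where b: "b > 0" "\<And>x. b * norm x \<le> norm (F' x)"
    using linear_inj_bounded_below_pos[OF has_derivative_linear[OF F] inj] by blast
  obtain e where e: "e > 0" "\<And>q. norm (q - p) < e \<Longrightarrow> norm (F q - F p - F' (q - p)) \<le> b / 2 * norm (q - p)"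
    using F[unfolded has_derivative_at_alt] b(1) by (meson half_gt_zero)
  show thesis
  proof (rule that[OF e(1)])
    fix q assume q: "dist p q < e" "F q = 0"
    have "b * norm (q - p) \<le> b / 2 * norm (q - p)"
      using e(2)[of q] b(2)[of "q - p"] q by (simp add: dist_norm norm_minus_commute 0)
    then show "q = p" using b(1) by (simp add: field_simps mult_le_0_iff)
  qed
qed

text \<open>\<open>F\<close> is the gradient with the factor \<open>\<epsilon>\<close> removed from
  its first component; the determinant of its derivative is exactly \<open>Jac\<close>.\<close>

lemma isolated_critical_point:
  assumes n: "1 \<le> n" and \<delta>: "\<delta> \<le> 1/4" and \<epsilon>: "\<epsilon> \<noteq> 0" and J: "Jac n a \<epsilon> x y \<noteq> 0"
    and crit: "(x, y) \<in> critical_points (R_approx n a \<epsilon>) (midstrip \<delta>)"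
  shows "(x, y) isolated_in critical_points (R_approx n a \<epsilon>) (midstrip \<delta>)"
proof -
  define F where "F = (\<lambda>p. (gx n a (fst p) (snd p), cot (pi * snd p) / 2 + \<epsilon> * gy n a (fst p) (snd p)))"
  define r where "r = - pi / (2 * (sin (pi * y))\<^sup>2)"
  define F' where "F' = (\<lambda>h. (gxx n a x y * fst h + gxy n a x y * snd h,
      snd h * r + \<epsilon> * (gxy n a x y * fst h + gyy n a x y * snd h)))"
  have c: "\<bar>y - 1/2\<bar> < \<delta>" "F (x, y) = 0"
    using crit unfolding critical_points_iff[OF n \<delta> \<epsilon>] by (auto simp: F_def zero_prod_def)
  have y: "0 < y" "y < 1" using c \<delta> by linarith+
  have C: "((\<lambda>p. cot (pi * snd p) / 2) has_derivative (\<lambda>h. snd h * r)) (at (x, y))"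
  proof (rule DERIV_compose_FDERIV[where f = "\<lambda>t. cot (pi * t) / 2" and g = snd])
    show "((\<lambda>t. cot (pi * t) / 2) has_real_derivative r) (at (snd (x, y)))"
      using DERIV_cdivide[OF DERIV_cot_pi[OF y], of 2] by (simp add: r_def mult.commute)
  qed (auto intro!: derivative_eq_intros)
  have F: "(F has_derivative F') (at (x, y))"
    unfolding F_def F'_def
    by (intro has_derivative_Pair has_derivative_gx y has_derivative_add C has_derivative_mult_right has_derivative_gy)
  have inj: "inj F'"
  proof (subst linear_injective_0[OF has_derivative_linear[OF F]], intro allI impI)
    fix h assume h: "F' h = 0"
    let ?a = "gxx n a x y" and ?b = "gxy n a x y" and ?d = "r + \<epsilon> * gyy n a x y"
    have e: "?a * fst h + ?b * snd h = 0" "\<epsilon> * ?b * fst h + ?d * snd h = 0"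
      using h by (auto simp: F'_def zero_prod_def algebra_simps)
    \<comment> \<open>Cramer's rule for the linear system \<open>e\<close>.\<close>
    have "Jac n a \<epsilon> x y * fst h = ?d * (?a * fst h + ?b * snd h) - ?b * (\<epsilon> * ?b * fst h + ?d * snd h)"
      "Jac n a \<epsilon> x y * snd h = ?a * (\<epsilon> * ?b * fst h + ?d * snd h) - \<epsilon> * ?b * (?a * fst h + ?b * snd h)"
      by (auto simp: Jac_def r_def algebra_simps power2_eq_square)
    then show "h = 0" using J unfolding e by (auto simp: prod_eq_iff)
  qed
  obtain e where e: "0 < e" "\<And>q. dist (x, y) q < e \<Longrightarrow> F q = 0 \<Longrightarrow> q = (x, y)"
    using isolated_zero[OF F inj c(2)] by blast
  have "F q = 0" if "q \<in> critical_points (R_approx n a \<epsilon>) (midstrip \<delta>)" for q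
    using that critical_points_iff[OF n \<delta> \<epsilon>, of "fst q" "snd q"] by (auto simp: F_def zero_prod_def)
  then show ?thesis
    unfolding isolated_in_dist_Ex_iff using e crit by blast
qed

subsection \<open>Solving for the vertical coordinate\<close>

lemma differentiable_bigo:
  fixes f :: "real \<Rightarrow> real"
  assumes diff: "f differentiable (at m)" and lim: "(y \<longlongrightarrow> m) F"
  shows "(\<lambda>x. f (y x) - f m) \<in> O[F](\<lambda>x. y x - m)"
proof -
  obtain f' where "(f has_real_derivative f') (at m)"
    using diff by (auto simp: real_differentiable_def)
  then have "((\<lambda>z. (f z - f m) / (z - m)) \<longlongrightarrow> f') (at m)"
    by (simp add: has_field_derivative_iff)
  then have "(\<lambda>z. f z - f m) \<in> O[at m](\<lambda>z. z - m)"
    by (rule bigoI_tendsto) (auto simp: eventually_at_filter)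
  then obtain L where L: "0 < L" "\<forall>\<^sub>F z in at m. \<bar>f z - f m\<bar> \<le> L * \<bar>z - m\<bar>"
    by (elim landau_o.bigE) auto
  \<comment> \<open>The bound is trivial at \<open>m\<close> itself; including that point matters
    because \<open>y x\<close> may equal \<open>m\<close>.\<close>
  then have "\<forall>\<^sub>F z in nhds m. \<bar>f z - f m\<bar> \<le> L * \<bar>z - m\<bar>"
    unfolding eventually_at_filter by (auto elim!: eventually_mono)
  with lim have "\<forall>\<^sub>F x in F. \<bar>f (y x) - f m\<bar> \<le> L * \<bar>y x - m\<bar>"
    by (auto simp: filterlim_iff)
  then show ?thesis by (intro bigoI[where c = L]) simp
qed

text \<open>The arctangent correction is at most M |\<epsilon>| on the interval, so for M
  |\<epsilon>| <= d the difference of the two sides changes sign between the endpoints. The same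
  bound makes every such solution O(\<epsilon>)-close to \<open>m\<close>, and feeding this back
  into \<open>H\<close> yields the second-order expansion. Uniqueness is not claimed here.\<close>

lemma solve_fixed_point:
  fixes H :: "real \<Rightarrow> real" and m :: real
  assumes d: "0 < d" and cont: "continuous_on {m - d..m + d} H"
    and diff: "H differentiable (at m)"
  obtains y where
    "\<forall>\<^sub>F \<epsilon> in at 0. \<bar>y \<epsilon> - m\<bar> \<le> d \<and> y \<epsilon> = m + arctan (2 * \<epsilon> * H (y \<epsilon>)) / pi"
    "(y \<longlongrightarrow> m) (at 0)" "(\<lambda>\<epsilon>. y \<epsilon> - m) \<in> O[at 0](\<lambda>\<epsilon>. \<epsilon>)"
    "(\<lambda>\<epsilon>. y \<epsilon> - (m + \<epsilon> * (2 / pi * H m))) \<in> O[at 0](\<lambda>\<epsilon>. \<epsilon>\<^sup>2)"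
proof -
  have "compact (H ` {m - d..m + d})"
    by (intro compact_continuous_image cont) auto
  then obtain M where M: "0 < M" "\<forall>v\<in>H ` {m - d..m + d}. norm v \<le> M"
    using compact_imp_bounded bounded_pos by metis
  have M': "\<bar>H y\<bar> \<le> M" if "\<bar>y - m\<bar> \<le> d" for y
    using M(2) that by (auto simp: abs_le_iff)
  have arctan_le: "\<bar>arctan t\<bar> \<le> \<bar>t\<bar>" for t
    using arctan_le_self[of "\<bar>t\<bar>"] by (cases "0 \<le> t") (auto simp: arctan_minus)
  let ?P = "\<lambda>\<epsilon> y. \<bar>y - m\<bar> \<le> d \<and> y = m + arctan (2 * \<epsilon> * H y) / pi"
  \<comment> \<open>The choice is made for every \<open>\<epsilon>\<close> but is meaningful only
    where a solution exists, hence the eventual form of the conclusions.\<close>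
  define y where "y = (\<lambda>\<epsilon>. SOME y. ?P \<epsilon> y)"
  have bnd: "\<bar>arctan (2 * \<epsilon> * H z) / pi\<bar> \<le> M * \<bar>\<epsilon>\<bar>" if "\<bar>z - m\<bar> \<le> d" for z \<epsilon>
  proof -
    have "\<bar>arctan (2 * \<epsilon> * H z) / pi\<bar> \<le> \<bar>2 * \<epsilon> * H z\<bar> / pi"
      using arctan_le by (simp add: divide_right_mono)
    also have "\<dots> \<le> 2 * \<bar>\<epsilon>\<bar> * M / 2"
      by (intro frac_le) (use M'[OF that] M(1) pi_ge_two in \<open>auto simp: abs_mult intro!: mult_left_mono\<close>)
    finally show ?thesis by (simp add: mult.commute)
  qed
  have ex: "\<exists>y. ?P \<epsilon> y" if "M * \<bar>\<epsilon>\<bar> \<le> d" for \<epsilon>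
  proof -
    let ?f = "\<lambda>y. y - m - arctan (2 * \<epsilon> * H y) / pi"
    have b: "\<bar>arctan (2 * \<epsilon> * H (m - d)) / pi\<bar> \<le> M * \<bar>\<epsilon>\<bar>"
      "\<bar>arctan (2 * \<epsilon> * H (m + d)) / pi\<bar> \<le> M * \<bar>\<epsilon>\<bar>"
      by (rule bnd, use d in simp)+
    have "\<exists>y\<ge>m - d. y \<le> m + d \<and> ?f y = 0"
    proof (rule IVT')
      show "?f (m - d) \<le> 0" "0 \<le> ?f (m + d)"
        using b that by linarith+
      show "continuous_on {m - d..m + d} ?f"
        by (intro continuous_intros cont) auto
    qed (use d in auto)
    then obtain y where "m - d \<le> y" "y \<le> m + d" "?f y = 0" by blast
    then have "?P \<epsilon> y" by linarith
    then show ?thesis by blast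
  qed
  have ev: "\<forall>\<^sub>F \<epsilon> in at 0. ?P \<epsilon> (y \<epsilon>)"
  proof -
    have "\<forall>\<^sub>F \<epsilon> in at 0. M * \<bar>\<epsilon>\<bar> < d"
    proof (rule order_tendstoD(2))
      show "((\<lambda>\<epsilon>. M * \<bar>\<epsilon>\<bar>) \<longlongrightarrow> M * \<bar>0\<bar>) (at 0)" by (intro tendsto_intros)
    qed (use d in simp)
    then show ?thesis
    proof eventually_elim
      case (elim \<epsilon>)
      then have "\<exists>y. ?P \<epsilon> y" by (intro ex) simp
      from someI_ex[OF this] show ?case unfolding y_def by blast
    qed
  qed
  have ev_bnd: "\<forall>\<^sub>F \<epsilon> in at 0. \<bar>y \<epsilon> - m\<bar> \<le> M * \<bar>\<epsilon>\<bar>"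
    using ev
  proof eventually_elim
    case (elim \<epsilon>)
    show ?case using bnd[OF conjunct1[OF elim], of \<epsilon>] elim by linarith
  qed
  have O1: "(\<lambda>\<epsilon>. y \<epsilon> - m) \<in> O[at 0](\<lambda>\<epsilon>. \<epsilon>)"
    by (rule bigoI[where c = M]) (use ev_bnd in simp)
  have lim: "(y \<longlongrightarrow> m) (at 0)"
  proof -
    have "((\<lambda>\<epsilon>. y \<epsilon> - m) \<longlongrightarrow> 0) (at 0)"
    proof (rule Lim_null_comparison)
      show "\<forall>\<^sub>F \<epsilon> in at 0. norm (y \<epsilon> - m) \<le> M * \<bar>\<epsilon>\<bar>" using ev_bnd by simp
      have "((\<lambda>\<epsilon>. M * \<bar>\<epsilon>\<bar>) \<longlongrightarrow> M * \<bar>0\<bar>) (at 0)" by (intro tendsto_intros)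
      then show "((\<lambda>\<epsilon>. M * \<bar>\<epsilon>\<bar>) \<longlongrightarrow> 0) (at 0)" by simp
    qed
    then show ?thesis by (simp add: LIM_zero_iff)
  qed
  obtain L where L: "0 < L" and evL: "\<forall>\<^sub>F \<epsilon> in at 0. \<bar>H (y \<epsilon>) - H m\<bar> \<le> L * \<bar>y \<epsilon> - m\<bar>"
    using differentiable_bigo[OF diff lim] by (elim landau_o.bigE) auto
  have "(\<lambda>t::real. arctan t - t) \<in> O[at 0](\<lambda>t. t\<^sup>2)" by real_asymp
  then obtain K where K: "0 < K" "\<forall>\<^sub>F t in at 0. \<bar>arctan t - t\<bar> \<le> K * t\<^sup>2"
    by (elim landau_o.bigE) auto
  then have "\<forall>\<^sub>F t in nhds 0. \<bar>arctan t - t\<bar> \<le> K * t\<^sup>2"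
    unfolding eventually_at_filter by (auto elim!: eventually_mono)
  moreover have "((\<lambda>\<epsilon>. 2 * \<epsilon> * H (y \<epsilon>)) \<longlongrightarrow> 2 * 0 * H m) (at 0)"
    by (intro tendsto_intros isCont_tendsto_compose[OF _ lim] differentiable_imp_continuous_within diff)
  ultimately have evK: "\<forall>\<^sub>F \<epsilon> in at 0. \<bar>arctan (2 * \<epsilon> * H (y \<epsilon>)) - 2 * \<epsilon> * H (y \<epsilon>)\<bar> \<le> K * (2 * \<epsilon> * H (y \<epsilon>))\<^sup>2"
    by (auto simp: filterlim_iff)
  have O2: "(\<lambda>\<epsilon>. y \<epsilon> - (m + \<epsilon> * (2 / pi * H m))) \<in> O[at 0](\<lambda>\<epsilon>. \<epsilon>\<^sup>2)"
  proof (rule bigoI[where c = "K * (2 * M)\<^sup>2 / pi + 2 / pi * (L * M)"])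
    show "\<forall>\<^sub>F \<epsilon> in at 0. norm (y \<epsilon> - (m + \<epsilon> * (2 / pi * H m)))
        \<le> (K * (2 * M)\<^sup>2 / pi + 2 / pi * (L * M)) * norm (\<epsilon>\<^sup>2)"
      using ev ev_bnd evL evK
    proof eventually_elim
      case (elim \<epsilon>)
      define h where "h = H (y \<epsilon>)"
      \<comment> \<open>Two errors of second order: linearizing the arctangent, and freezing
        \<open>H\<close> at \<open>m\<close>. The latter is first order in y - m and carries another
        factor \<open>\<epsilon>\<close>.\<close>
      have "y \<epsilon> - (m + \<epsilon> * (2 / pi * H m)) = (arctan (2 * \<epsilon> * h) - 2 * \<epsilon> * h) / pi + 2 * \<epsilon> / pi * (h - H m)"
      proof -
        have "y \<epsilon> = m + arctan (2 * \<epsilon> * h) / pi" using elim(1) unfolding h_def by blast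
        then show ?thesis by (simp add: field_simps)
      qed
      also have "\<bar>\<dots>\<bar> \<le> \<bar>arctan (2 * \<epsilon> * h) - 2 * \<epsilon> * h\<bar> / pi + 2 * \<bar>\<epsilon>\<bar> / pi * \<bar>h - H m\<bar>"
        by (intro order_trans[OF abs_triangle_ineq]) (simp add: abs_mult)
      also have "\<dots> \<le> K * (2 * M)\<^sup>2 * \<epsilon>\<^sup>2 / pi + 2 * \<bar>\<epsilon>\<bar> / pi * (L * (M * \<bar>\<epsilon>\<bar>))"
      proof (intro add_mono divide_right_mono mult_left_mono)
        have "\<bar>h\<bar> \<le> M" using M'[OF conjunct1[OF elim(1)]] by (simp add: h_def)
        then have "h\<^sup>2 \<le> M\<^sup>2" using abs_le_square_iff[of h M] M(1) by simp
        then have "K * (2 * \<epsilon> * h)\<^sup>2 \<le> K * (2 * M)\<^sup>2 * \<epsilon>\<^sup>2"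
          using K(1) by (simp add: power_mult_distrib mult_left_mono mult.left_commute[of _ "\<epsilon>\<^sup>2"] mult.commute[of _ "\<epsilon>\<^sup>2"])
        then show "\<bar>arctan (2 * \<epsilon> * h) - 2 * \<epsilon> * h\<bar> \<le> K * (2 * M)\<^sup>2 * \<epsilon>\<^sup>2"
          using elim(4) by (simp add: h_def)
        have "L * \<bar>y \<epsilon> - m\<bar> \<le> L * (M * \<bar>\<epsilon>\<bar>)" using elim(2) L by simp
        then show "\<bar>h - H m\<bar> \<le> L * (M * \<bar>\<epsilon>\<bar>)" using elim(3) by (simp add: h_def)
      qed auto
      also have "\<dots> = (K * (2 * M)\<^sup>2 / pi + 2 / pi * (L * M)) * \<epsilon>\<^sup>2"
        unfolding power2_eq_square[of \<epsilon>] abs_mult_self_eq[of \<epsilon>, symmetric] by (simp add: algebra_simps)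
      finally show ?case by simp
    qed
  qed
  show thesis using that[OF ev lim O1 O2] .
qed

text \<open>cot (pi / 2 + t) = - tan t.\<close>

lemma cot_eq_of_arctan:
  assumes "y = 1/2 + arctan (2 * w) / pi"
  shows "cot (pi * y) / 2 + w = 0"
proof -
  have "pi * y = pi / 2 + arctan (2 * w)" using assms by (simp add: field_simps)
  then have "cot (pi * y) = - tan (arctan (2 * w))"
    by (simp add: cot_def tan_def cos_add sin_add)
  then show ?thesis by (simp add: tan_arctan)
qed

text \<open>\<open>\<gamma>\<close> prescribes cos x as a function of the height: the constants 1
  and -1 on the axes, a root curve elsewhere. Continuity on the interval serves existence,
  differentiability at 1/2 the expansion.\<close>

lemma solve_y:
  fixes \<gamma> :: "real \<Rightarrow> real"
  assumes n: "1 \<le> n" and d: "0 < d" "d \<le> 1/4" and cont: "continuous_on {1/2 - d..1/2 + d} \<gamma>"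
    and diff: "\<gamma> differentiable (at (1/2))"
  obtains y where
    "\<forall>\<^sub>F \<epsilon> in at 0. \<bar>y \<epsilon> - 1/2\<bar> \<le> d \<and>
       cot (pi * y \<epsilon>) / 2 + \<epsilon> * (B' 1 (y \<epsilon>) * \<gamma> (y \<epsilon>) + a * B' n (y \<epsilon>) * poly (cheb_T n) (\<gamma> (y \<epsilon>))) = 0"
    "(y \<longlongrightarrow> 1/2) (at 0)" "(\<lambda>\<epsilon>. y \<epsilon> - 1/2) \<in> O[at 0](\<lambda>\<epsilon>. \<epsilon>)"
    "(\<lambda>\<epsilon>. y \<epsilon> - (1/2 + \<epsilon> * Yshift n a (\<gamma> (1/2)))) \<in> O[at 0](\<lambda>\<epsilon>. \<epsilon>\<^sup>2)"
proof -
  define H where "H = (\<lambda>y. B' 1 y * \<gamma> y + a * B' n y * poly (cheb_T n) (\<gamma> y))"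
  have B': "B' k differentiable (at y)" if "y \<in> {1/2 - d..1/2 + d}" for k y
    using DERIV_B'[of y k] that d by (auto simp: real_differentiable_def)
  then have contB': "continuous_on {1/2 - d..1/2 + d} (B' k)" for k
    by (meson continuous_at_imp_continuous_on differentiable_imp_continuous_within)
  have contH: "continuous_on {1/2 - d..1/2 + d} H"
    unfolding H_def by (intro continuous_intros cont contB')
  have T: "(\<lambda>y. poly (cheb_T n) (\<gamma> y)) differentiable (at (1/2))"
    by (rule differentiable_compose[of "poly (cheb_T n)"])
      (use diff in \<open>auto simp: real_differentiable_def intro: poly_DERIV\<close>)
  have diffH: "H differentiable (at (1/2))"
    unfolding H_def using d by (intro derivative_intros B' T diff) auto
  obtain y where y:
    "\<forall>\<^sub>F \<epsilon> in at 0. \<bar>y \<epsilon> - 1/2\<bar> \<le> d \<and> y \<epsilon> = 1/2 + arctan (2 * \<epsilon> * H (y \<epsilon>)) / pi"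
    "(y \<longlongrightarrow> 1/2) (at 0)" "(\<lambda>\<epsilon>. y \<epsilon> - 1/2) \<in> O[at 0](\<lambda>\<epsilon>. \<epsilon>)"
    "(\<lambda>\<epsilon>. y \<epsilon> - (1/2 + \<epsilon> * (2 / pi * H (1/2)))) \<in> O[at 0](\<lambda>\<epsilon>. \<epsilon>\<^sup>2)"
    using solve_fixed_point[OF d(1) contH diffH] by blast
  \<comment> \<open>The 2 / pi of the expansion meets the 1 / (4 pi) in \<open>B'_half\<close>,
    which gives 1 / (2 pi^2).\<close>
  have Y: "2 / pi * H (1/2) = Yshift n a (\<gamma> (1/2))"
    unfolding H_def B'_half[OF n] B'_half[OF order_refl] Yshift_def
    by (simp add: field_simps power2_eq_square)
  show thesis
  proof (rule that[of y])
    show "\<forall>\<^sub>F \<epsilon> in at 0. \<bar>y \<epsilon> - 1/2\<bar> \<le> d \<and>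
       cot (pi * y \<epsilon>) / 2 + \<epsilon> * (B' 1 (y \<epsilon>) * \<gamma> (y \<epsilon>) + a * B' n (y \<epsilon>) * poly (cheb_T n) (\<gamma> (y \<epsilon>))) = 0"
      using y(1)
    proof eventually_elim
      case (elim \<epsilon>)
      then show ?case
        using cot_eq_of_arctan[of "y \<epsilon>" "\<epsilon> * H (y \<epsilon>)"] by (auto simp: H_def mult.assoc)
    qed
  qed (use y(2,3) y(4)[unfolded Y] in auto)
qed

lemma inverse_poly:
  fixes p :: "real poly"
  assumes "poly (pderiv p) c \<noteq> 0"
  obtains V \<phi> where "open V" "poly p c \<in> V" "\<phi> (poly p c) = c"
    "\<And>v. v \<in> V \<Longrightarrow> poly p (\<phi> v) = v" "\<And>v. v \<in> V \<Longrightarrow> \<phi> differentiable (at v)"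
proof -
  define f' where "f' = (\<lambda>x. blinfun_scaleR_left (poly (pderiv p) x) :: real \<Rightarrow>\<^sub>L real)"
  define i where "i = (blinfun_scaleR_left (inverse (poly (pderiv p) c)) :: real \<Rightarrow>\<^sub>L real)"
  have 1: "(poly p has_derivative blinfun_apply (f' x)) (at x)" for x
    by (rule has_derivative_eq_rhs[OF poly_DERIV[of p x, unfolded has_field_derivative_def]])
      (simp add: f'_def fun_eq_iff)
  have 2: "continuous_on UNIV f'"
    unfolding f'_def by (intro continuous_intros)
  have 3: "i o\<^sub>L f' c = id_blinfun"
    using assms by (intro blinfun_eqI) (simp add: i_def f'_def)
  show thesis
  proof (rule inverse_function_theorem[OF open_UNIV 1 2 UNIV_I 3])
    fix U' V g g'
    assume "open V" "poly p c \<in> V" "c \<in> U'" and h: "homeomorphism U' V (poly p) g"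
      and g: "\<And>y. y \<in> V \<Longrightarrow> (g has_derivative (g' y)) (at y)"
    then show thesis
      by (intro that[of V g]) (auto simp: homeomorphism_def differentiable_def)
  qed
qed

subsection \<open>Nondegeneracy\<close>

text \<open>Separates the two kinds of critical points: sin x vanishes on the axes, the other factor
  on the root curves.\<close>

lemma gx_cheb:
  assumes "1 \<le> n"
  shows "gx n a x y = - (sin x * (B 1 y + a * real n * B n y * poly (cheb_U (n - 1)) (cos x)))"
proof -
  have "sin (real n * x) = sin x * poly (cheb_U (n - 1)) (cos x)"
    using poly_cheb_U_cos[of x "n - 1"] assms by simp
  then show ?thesis by (simp add: gx_def algebra_simps)
qed

lemma gy_cheb: "gy n a x y = B' 1 y * cos x + a * B' n y * poly (cheb_T n) (cos x)"
  by (simp add: gy_def poly_cheb_T_cos)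

text \<open>Obtained by differentiating the factored form of \<open>gx\<close>. At a zero of
  \<open>gx\<close>, the second summand vanishes on an axis and the first one off the axes.\<close>

lemma gxx_cheb:
  assumes n: "1 \<le> n" and y: "0 < y" "y < 1"
  shows "gxx n a x y = - (cos x * (B 1 y + a * real n * B n y * poly (cheb_U (n - 1)) (cos x)))
    + (sin x)\<^sup>2 * (a * real n * B n y * poly (pderiv (cheb_U (n - 1))) (cos x))"
proof (rule DERIV_unique[OF DERIV_gx(1)[OF y]])
  have P: "((\<lambda>x. poly (cheb_U (n - 1)) (cos x)) has_real_derivative
      poly (pderiv (cheb_U (n - 1))) (cos x) * - sin x) (at x)"
    by (rule DERIV_chain2[OF poly_DERIV]) (auto intro!: derivative_eq_intros)
  show "((\<lambda>x. gx n a x y) has_real_derivative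
      - (cos x * (B 1 y + a * real n * B n y * poly (cheb_U (n - 1)) (cos x)))
      + (sin x)\<^sup>2 * (a * real n * B n y * poly (pderiv (cheb_U (n - 1))) (cos x))) (at x)"
    unfolding gx_cheb[OF n]
    by (rule derivative_eq_intros P refl)+ (simp add: algebra_simps power2_eq_square)
qed

lemma poly_cheb_U_1: "poly (cheb_U m) 1 = real m + 1"
  by (induction m rule: cheb_U.induct) (auto simp: algebra_simps)

lemma poly_cheb_U_minus_1: "poly (cheb_U m) (-1) = (-1) ^ m * (real m + 1)"
  by (induction m rule: cheb_U.induct) (auto simp: algebra_simps)

lemma B_half_pos: "1 \<le> k \<Longrightarrow> 0 < B k (1/2)"
  by (simp add: B_half)

text \<open>By \<open>B_half\<close> the factors 1 / (4 pi) cancel, and one of the two factors n in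
  \<open>Lam\<close> comes from \<open>B n (1/2)\<close>. So \<open>Lam n a\<close> is the value
  that \<open>cheb_U (n - 1)\<close> must take for the non-axial factor of \<open>gx\<close> to
  vanish on the centerline.\<close>

lemma Lam_eq:
  assumes "1 \<le> n" "a \<noteq> 0"
  shows "Lam n a = - B 1 (1/2) / (a * real n * B n (1/2))"
  using assms unfolding Lam_def B_half[OF assms(1)] B_half[OF order_refl]
  by (simp add: field_simps power2_eq_square)

lemma critical_factor_half_iff:
  assumes "1 \<le> n" "a \<noteq> 0"
  shows "B 1 (1/2) + a * real n * B n (1/2) * u = 0 \<longleftrightarrow> u = Lam n a"
proof -
  have "a * real n * B n (1/2) \<noteq> 0" using assms B_half_pos[of n] by simp
  then show ?thesis unfolding Lam_eq[OF assms] by (auto simp: field_simps eq_neg_iff_add_eq_0)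
qed

text \<open>On an axis a common zero would force the non-axial factor \<open>Q\<close> to vanish at
  cos x = 1 or -1, which \<open>ends\<close> forbids. Off the axes \<open>Q\<close> is 0, and
  \<open>gxx\<close> is a nonzero multiple of the derivative of \<open>cheb_U (n - 1)\<close> at a
  root, which \<open>simple\<close> keeps away from 0.\<close>

lemma gx_gxx_half_not_both_0:
  assumes n: "1 \<le> n" and a: "a \<noteq> 0"
    and simple: "\<And>c. \<lbrakk>-1 < c; c < 1; poly (cheb_U (n - 1)) c = Lam n a\<rbrakk>
           \<Longrightarrow> poly (pderiv (cheb_U (n - 1))) c \<noteq> 0"
    and ends: "Lam n a \<notin> {real n, (-1) ^ (n - 1) * real n}"
    and gx: "gx n a x (1/2) = 0"
  shows "gxx n a x (1/2) \<noteq> 0"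
proof
  assume gxx: "gxx n a x (1/2) = 0"
  define Q where "Q = B 1 (1/2) + a * real n * B n (1/2) * poly (cheb_U (n - 1)) (cos x)"
  have e: "sin x * Q = 0"
    "cos x * Q = (sin x)\<^sup>2 * (a * real n * B n (1/2) * poly (pderiv (cheb_U (n - 1))) (cos x))"
    using gx gxx unfolding gx_cheb[OF n] by (simp_all add: gxx_cheb[OF n] Q_def)
  have Q: "Q = 0 \<longleftrightarrow> poly (cheb_U (n - 1)) (cos x) = Lam n a"
    unfolding Q_def by (rule critical_factor_half_iff[OF n a])
  show False
  proof (cases "sin x = 0")
    case True
    then have c: "cos x = 1 \<or> cos x = -1"
      using sin_zero_abs_cos_one[of x] by auto
    then have "Q = 0" using e(2) True by auto
    then have "Lam n a = poly (cheb_U (n - 1)) (cos x)" using Q by simp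
    also have "\<dots> \<in> {real n, (-1) ^ (n - 1) * real n}"
      using c n by (auto simp: poly_cheb_U_1 poly_cheb_U_minus_1 of_nat_diff)
    finally show False using ends by simp
  next
    case False
    have "(cos x)\<^sup>2 < 1" using False by (simp add: cos_squared_eq)
    then have "\<bar>cos x\<bar> < 1" by (simp add: abs_square_less_1)
    then have c: "-1 < cos x" "cos x < 1" by linarith+
    have "Q = 0" using e(1) False by simp
    then have "poly (pderiv (cheb_U (n - 1))) (cos x) \<noteq> 0" using simple[OF c] Q by simp
    moreover have "poly (pderiv (cheb_U (n - 1))) (cos x) = 0"
      using e(2) \<open>Q = 0\<close> False a n B_half_pos[of n] by simp
    ultimately show False by simp
  qed
qed

text \<open>Reduces the unbounded \<open>x\<close> to a compact interval, on which a minimum is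
  attained.\<close>

lemma gx_gxx_periodic:
  obtains t where "0 \<le> t" "t \<le> 2 * pi" "gx n a x y = gx n a t y" "gxx n a x y = gxx n a t y"
proof -
  have "[x rmod (2 * pi) = x] (rmod (2 * pi))" by simp
  then obtain m :: int where m: "x = x rmod (2 * pi) + of_int m * (2 * pi)"
    unfolding rcong_altdef by blast
  have "real n * x = real n * (x rmod (2 * pi)) + 2 * pi * of_int (int n * m)"
    by (subst m) (simp add: algebra_simps)
  then have "sin (real n * x) = sin (real n * (x rmod (2 * pi))) \<and> cos (real n * x) = cos (real n * (x rmod (2 * pi)))"
    unfolding sin_cos_eq_iff by blast
  then show thesis
    by (intro that[of "x rmod (2 * pi)"])
      (auto simp: gx_def gxx_def rmod_nonneg intro!: less_imp_le rmod_less)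
qed

section \<open>Bounds uniform in x near the centerline\<close>

lemma isCont_B: "0 < y \<Longrightarrow> y < 1 \<Longrightarrow> isCont (B k) y"
  using DERIV_B DERIV_isCont by blast

lemma isCont_B': "0 < y \<Longrightarrow> y < 1 \<Longrightarrow> isCont (B' k) y"
  using DERIV_B' DERIV_isCont by blast

text \<open>Let m > 0 be the minimum of |gx| + |gxx| on the centerline. Moving to height
  \<open>y\<close> changes each term by at most e y < m / 4. If \<open>gx\<close> vanishes at height
  \<open>y\<close>, then |gx| < m / 4 on the centerline, so |gxx| > 3 m / 4 there and |gxx| > m / 2
  at height \<open>y\<close>.\<close>

lemma gxx_bounded_below:
  assumes n: "1 \<le> n" and a: "a \<noteq> 0"
    and simple: "\<And>c. \<lbrakk>-1 < c; c < 1; poly (cheb_U (n - 1)) c = Lam n a\<rbrakk>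
           \<Longrightarrow> poly (pderiv (cheb_U (n - 1))) c \<noteq> 0"
    and ends: "Lam n a \<notin> {real n, (-1) ^ (n - 1) * real n}"
  obtains \<delta> \<kappa> where "0 < \<delta>" "\<delta> \<le> 1/4" "0 < \<kappa>"
    "\<And>x y. \<lbrakk>\<bar>y - 1/2\<bar> < \<delta>; gx n a x y = 0\<rbrakk> \<Longrightarrow> \<kappa> \<le> \<bar>gxx n a x y\<bar>"
proof -
  define f where "f = (\<lambda>x. \<bar>gx n a x (1/2)\<bar> + \<bar>gxx n a x (1/2)\<bar>)"
  have "continuous_on {0..2 * pi} f"
    unfolding f_def gx_def gxx_def by (intro continuous_intros)
  then obtain x0 where "\<forall>x\<in>{0..2 * pi}. f x0 \<le> f x"
    using continuous_attains_inf[of "{0..2 * pi}" f] by auto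
  then have x0: "f x0 \<le> f x" if "0 \<le> x" "x \<le> 2 * pi" for x
    using that by auto
  define m where "m = f x0"
  have m: "0 < m"
    using gx_gxx_half_not_both_0[OF n a simple ends, of x0] by (fastforce simp: m_def f_def)
  have m_le: "m \<le> f x" for x
    by (rule gx_gxx_periodic[of n a x "1/2"]) (use x0 in \<open>simp add: m_def f_def\<close>)
  \<comment> \<open>A bound independent of \<open>x\<close>; the weight n^2 covers both the factor n
    in \<open>gx\<close> and the factor n^2 in \<open>gxx\<close>.\<close>
  define e where "e = (\<lambda>y. \<bar>B 1 y - B 1 (1/2)\<bar> + \<bar>a\<bar> * (real n)\<^sup>2 * \<bar>B n y - B n (1/2)\<bar>)"
  have "isCont e (1/2)"
    unfolding e_def by (intro continuous_intros isCont_B) auto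
  then have "(e \<longlongrightarrow> 0) (at (1/2))" by (simp add: isCont_def e_def)
  then have "\<forall>\<^sub>F y in at (1/2). e y < m / 4"
    using m by (intro order_tendstoD) auto
  then obtain d where d: "0 < d" "\<And>y. y \<noteq> 1/2 \<Longrightarrow> \<bar>y - 1/2\<bar> < d \<Longrightarrow> e y < m / 4"
    unfolding eventually_at by (auto simp: dist_real_def)
  have e: "e y < m / 4" if "\<bar>y - 1/2\<bar> < d" for y
  proof (cases "y = 1/2")
    case True
    show ?thesis unfolding True e_def using m by simp
  qed (use d(2) that in blast)
  show thesis
  proof (rule that[of "min d (1/4)" "m / 2"])
    fix x y :: real
    assume y: "\<bar>y - 1/2\<bar> < min d (1/4)" and gx: "gx n a x y = 0"
    have le: "\<bar>u * p + v * q\<bar> \<le> \<bar>u\<bar> + w * \<bar>v\<bar>" if "\<bar>p\<bar> \<le> 1" "\<bar>q\<bar> \<le> w" for u v p q w :: real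
    proof -
      have "\<bar>u * p\<bar> \<le> \<bar>u\<bar> * 1" "\<bar>v * q\<bar> \<le> \<bar>v\<bar> * w"
        unfolding abs_mult using that by (intro mult_left_mono; simp)+
      then show ?thesis by (simp add: mult.commute)
    qed
    have nn: "real n \<le> (real n)\<^sup>2" using n by (simp add: power2_eq_square)
    have an: "\<bar>a * real n * sin (real n * x)\<bar> \<le> \<bar>a\<bar> * (real n)\<^sup>2"
      "\<bar>a * (real n)\<^sup>2 * cos (real n * x)\<bar> \<le> \<bar>a\<bar> * (real n)\<^sup>2"
    proof -
      have "\<bar>a * real n * sin (real n * x)\<bar> \<le> \<bar>a\<bar> * real n * 1"
        unfolding abs_mult by (intro mult_mono) auto
      also have "\<dots> \<le> \<bar>a\<bar> * (real n)\<^sup>2" using nn by (simp add: mult_left_mono)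
      finally show "\<bar>a * real n * sin (real n * x)\<bar> \<le> \<bar>a\<bar> * (real n)\<^sup>2" .
      have "\<bar>a * (real n)\<^sup>2 * cos (real n * x)\<bar> \<le> \<bar>a\<bar> * (real n)\<^sup>2 * 1"
        unfolding abs_mult by (intro mult_mono) auto
      then show "\<bar>a * (real n)\<^sup>2 * cos (real n * x)\<bar> \<le> \<bar>a\<bar> * (real n)\<^sup>2" by simp
    qed
    have "\<bar>gx n a x y - gx n a x (1/2)\<bar> =
        \<bar>(B 1 y - B 1 (1/2)) * sin x + (B n y - B n (1/2)) * (a * real n * sin (real n * x))\<bar>"
      unfolding gx_def by (subst abs_minus_cancel[symmetric]) (simp add: algebra_simps)
    also have "\<dots> \<le> e y" unfolding e_def by (intro le an) auto
    finally have 1: "\<bar>gx n a x y - gx n a x (1/2)\<bar> \<le> e y" .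
    have "\<bar>gxx n a x y - gxx n a x (1/2)\<bar> =
        \<bar>(B 1 y - B 1 (1/2)) * cos x + (B n y - B n (1/2)) * (a * (real n)\<^sup>2 * cos (real n * x))\<bar>"
      unfolding gxx_def by (subst abs_minus_cancel[symmetric]) (simp add: algebra_simps)
    also have "\<dots> \<le> e y" unfolding e_def by (intro le an) auto
    finally have 2: "\<bar>gxx n a x y - gxx n a x (1/2)\<bar> \<le> e y" .
    show "m / 2 \<le> \<bar>gxx n a x y\<bar>"
      using 1 2 gx m_le[of x] e[of y] y unfolding f_def by linarith
  qed (use d m in auto)
qed

lemma second_derivatives_bounded:
  obtains M where "0 < M"
    "\<And>x y. \<bar>y - 1/2\<bar> \<le> 1/4 \<Longrightarrow> \<bar>gxy n a x y\<bar> \<le> M \<and> \<bar>gyy n a x y\<bar> \<le> M"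
proof -
  have bnd: "\<exists>M>0. \<forall>y. \<bar>y - 1/2\<bar> \<le> 1/4 \<longrightarrow> \<bar>f y\<bar> \<le> M"
    if "\<And>y. 0 < y \<Longrightarrow> y < 1 \<Longrightarrow> isCont f y" for f :: "real \<Rightarrow> real"
  proof -
    have "compact (f ` {1/4..3/4})"
      using that by (intro compact_continuous_image continuous_at_imp_continuous_on) auto
    then obtain M where M: "0 < M" "\<forall>v\<in>f ` {1/4..3/4}. norm v \<le> M"
      using compact_imp_bounded bounded_pos by metis
    have "\<bar>f y\<bar> \<le> M" if "\<bar>y - 1/2\<bar> \<le> 1/4" for y
    proof -
      have "y \<in> {1/4..3/4}" using that unfolding abs_le_iff atLeastAtMost_iff by linarith
      then show ?thesis using M(2) by auto
    qed
    then show ?thesis using M(1) by blast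
  qed
  obtain M1 where M1: "0 < M1" "\<And>y. \<bar>y - 1/2\<bar> \<le> 1/4 \<Longrightarrow> \<bar>B' 1 y\<bar> \<le> M1"
    using bnd[OF isCont_B'] by metis
  obtain M2 where M2: "0 < M2" "\<And>y. \<bar>y - 1/2\<bar> \<le> 1/4 \<Longrightarrow> \<bar>B' n y\<bar> \<le> M2"
    using bnd[OF isCont_B'] by metis
  obtain M3 where M3: "0 < M3" "\<And>y. \<bar>y - 1/2\<bar> \<le> 1/4 \<Longrightarrow> \<bar>B'' 1 y\<bar> \<le> M3"
    using bnd[OF isCont_B''] by metis
  obtain M4 where M4: "0 < M4" "\<And>y. \<bar>y - 1/2\<bar> \<le> 1/4 \<Longrightarrow> \<bar>B'' n y\<bar> \<le> M4"
    using bnd[OF isCont_B''] by metis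
  show thesis
  proof (rule that[of "(M1 + \<bar>a\<bar> * real n * M2) + (M3 + \<bar>a\<bar> * M4)"])
    show "0 < (M1 + \<bar>a\<bar> * real n * M2) + (M3 + \<bar>a\<bar> * M4)"
      using M1 M2 M3 M4 by (auto intro!: add_pos_nonneg add_nonneg_nonneg mult_nonneg_nonneg)
    fix x y :: real assume y: "\<bar>y - 1/2\<bar> \<le> 1/4"
    have "\<bar>gxy n a x y\<bar> \<le> \<bar>B' 1 y\<bar> * \<bar>sin x\<bar> + \<bar>a\<bar> * real n * \<bar>B' n y\<bar> * \<bar>sin (real n * x)\<bar>"
      unfolding gxy_def abs_minus_cancel by (intro order_trans[OF abs_triangle_ineq]) (simp add: abs_mult)
    also have "\<dots> \<le> M1 * 1 + \<bar>a\<bar> * real n * M2 * 1"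
      using M1 M2 y by (intro add_mono mult_mono) auto
    finally have 1: "\<bar>gxy n a x y\<bar> \<le> M1 + \<bar>a\<bar> * real n * M2" by simp
    have "\<bar>gyy n a x y\<bar> \<le> \<bar>B'' 1 y\<bar> * \<bar>cos x\<bar> + \<bar>a\<bar> * \<bar>B'' n y\<bar> * \<bar>cos (real n * x)\<bar>"
      unfolding gyy_def by (intro order_trans[OF abs_triangle_ineq]) (simp add: abs_mult)
    also have "\<dots> \<le> M3 * 1 + \<bar>a\<bar> * M4 * 1"
      using M3 M4 y by (intro add_mono mult_mono) auto
    finally have 2: "\<bar>gyy n a x y\<bar> \<le> M3 + \<bar>a\<bar> * M4" by simp
    have "0 \<le> M1 + \<bar>a\<bar> * real n * M2" "0 \<le> M3 + \<bar>a\<bar> * M4"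
      using M1 M2 M3 M4 by auto
    then show "\<bar>gxy n a x y\<bar> \<le> (M1 + \<bar>a\<bar> * real n * M2) + (M3 + \<bar>a\<bar> * M4) \<and>
        \<bar>gyy n a x y\<bar> \<le> (M1 + \<bar>a\<bar> * real n * M2) + (M3 + \<bar>a\<bar> * M4)"
      using 1 2 by linarith
  qed
qed

lemma eventually_at_0_abs_less: "0 < (e::real) \<Longrightarrow> \<forall>\<^sub>F \<epsilon> in at (0::real). \<bar>\<epsilon>\<bar> < e"
  by (auto simp: eventually_at dist_real_def)

text \<open>Uniform strict concavity of \<open>R0\<close>: a small perturbation keeps the second
  \<open>y\<close>-derivative negative, which serves both nondegeneracy and uniqueness of the
  height.\<close>

lemma R0_second_deriv_le:
  "0 < y \<Longrightarrow> y < 1 \<Longrightarrow> - pi / (2 * (sin (pi * y))\<^sup>2) \<le> - pi / 2"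
proof -
  assume y: "0 < y" "y < 1"
  have "(sin (pi * y))\<^sup>2 \<le> 1" by (simp add: abs_square_le_1)
  then have "pi / 2 \<le> pi / (2 * (sin (pi * y))\<^sup>2)"
    using sin_pi_mult_pos[OF y] by (intro frac_le) auto
  then show ?thesis by simp
qed

lemma eventually_Jac_nonzero:
  assumes \<delta>: "\<delta> \<le> 1/4" and \<kappa>: "0 < \<kappa>"
    and lower: "\<And>x y. \<lbrakk>\<bar>y - 1/2\<bar> < \<delta>; gx n a x y = 0\<rbrakk> \<Longrightarrow> \<kappa> \<le> \<bar>gxx n a x y\<bar>"
  shows "\<forall>\<^sub>F \<epsilon> in at 0. \<forall>x y. \<bar>y - 1/2\<bar> < \<delta> \<longrightarrow> gx n a x y = 0 \<longrightarrow> Jac n a \<epsilon> x y \<noteq> 0"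
proof -
  obtain M where M: "0 < M"
    "\<And>x y. \<bar>y - 1/2\<bar> \<le> 1/4 \<Longrightarrow> \<bar>gxy n a x y\<bar> \<le> M \<and> \<bar>gyy n a x y\<bar> \<le> M"
    using second_derivatives_bounded by blast
  \<comment> \<open>The first bound keeps the \<open>yy\<close> entry below - pi / 2 + 1 / 2 <= - 1
    / 2, so the diagonal product has absolute value at least \<kappa> / 2. The second keeps
    |\<epsilon>| gxy^2 strictly below \<kappa> / 2.\<close>
  have "\<forall>\<^sub>F \<epsilon> in at 0. \<bar>\<epsilon>\<bar> < 1 / (2 * M)" "\<forall>\<^sub>F \<epsilon> in at 0. \<bar>\<epsilon>\<bar> < \<kappa> / (2 * M\<^sup>2)"
    using M(1) \<kappa> by (auto intro!: eventually_at_0_abs_less)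
  then show ?thesis
  proof eventually_elim
    case (elim \<epsilon>)
    show ?case
    proof (intro allI impI notI)
      fix x y assume y: "\<bar>y - 1/2\<bar> < \<delta>" and gx: "gx n a x y = 0" and J: "Jac n a \<epsilon> x y = 0"
      define r where "r = - pi / (2 * (sin (pi * y))\<^sup>2) + \<epsilon> * gyy n a x y"
      have y': "\<bar>y - 1/2\<bar> \<le> 1/4" "0 < y" "y < 1" using y \<delta> by linarith+
      have "\<bar>\<epsilon> * gyy n a x y\<bar> \<le> \<bar>\<epsilon>\<bar> * M"
        unfolding abs_mult using M(2)[OF y'(1)] by (simp add: mult_left_mono)
      also have "\<dots> \<le> 1 / 2" using elim(1) M(1) by (simp add: field_simps)
      finally have "r \<le> - 1 / 2"
        using R0_second_deriv_le[OF y'(2,3)] pi_ge_two unfolding r_def by linarith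
      then have "\<kappa> * (1 / 2) \<le> \<bar>gxx n a x y\<bar> * \<bar>r\<bar>"
        using lower[OF y gx] by (intro mult_mono) auto
      also have "\<dots> = \<bar>\<epsilon>\<bar> * (gxy n a x y)\<^sup>2"
        using J unfolding Jac_def r_def[symmetric] by (simp add: abs_mult[symmetric]) (simp add: abs_mult)
      also have "\<dots> \<le> \<bar>\<epsilon>\<bar> * M\<^sup>2"
        using M abs_le_square_iff[of "gxy n a x y" M] M(2)[OF y'(1), of x] by (simp add: mult_left_mono)
      also have "\<dots> < \<kappa> * (1 / 2)" using elim(2) M(1) by (simp add: field_simps)
      finally show False by simp
    qed
  qed
qed

text \<open>For small \<open>\<epsilon>\<close> the left-hand side is strictly decreasing in
  \<open>y\<close>, so by the mean value theorem each vertical line carries at most one solution.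
  This complements the existence in \<open>solve_y\<close>.\<close>

lemma eventually_unique_y:
  assumes \<delta>: "\<delta> \<le> 1/4"
  shows "\<forall>\<^sub>F \<epsilon> in at 0. \<forall>x y y'. \<bar>y - 1/2\<bar> < \<delta> \<longrightarrow> \<bar>y' - 1/2\<bar> < \<delta> \<longrightarrow>
    cot (pi * y) / 2 + \<epsilon> * gy n a x y = 0 \<longrightarrow> cot (pi * y') / 2 + \<epsilon> * gy n a x y' = 0 \<longrightarrow> y = y'"
proof -
  obtain M where M: "0 < M"
    "\<And>x y. \<bar>y - 1/2\<bar> \<le> 1/4 \<Longrightarrow> \<bar>gxy n a x y\<bar> \<le> M \<and> \<bar>gyy n a x y\<bar> \<le> M"
    using second_derivatives_bounded by blast
  have "\<forall>\<^sub>F \<epsilon> in at 0. \<bar>\<epsilon>\<bar> < 1 / (2 * M)"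
    using M(1) by (auto intro!: eventually_at_0_abs_less)
  then show ?thesis
  proof eventually_elim
    case (elim \<epsilon>)
    have no: False if "u < v" "\<bar>u - 1/2\<bar> < \<delta>" "\<bar>v - 1/2\<bar> < \<delta>"
      "cot (pi * u) / 2 + \<epsilon> * gy n a x u = 0" "cot (pi * v) / 2 + \<epsilon> * gy n a x v = 0" for x u v
    proof -
      have D: "((\<lambda>y. cot (pi * y) / 2 + \<epsilon> * gy n a x y) has_real_derivative
          - (pi / (sin (pi * z))\<^sup>2) / 2 + \<epsilon> * gyy n a x z) (at z)" if "u \<le> z" "z \<le> v" for z
        by (intro DERIV_add DERIV_cdivide DERIV_cmult DERIV_gy DERIV_cot_pi; use \<delta> that \<open>\<bar>u - 1/2\<bar> < \<delta>\<close> \<open>\<bar>v - 1/2\<bar> < \<delta>\<close> in linarith)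
      obtain z where z: "u < z" "z < v"
        "cot (pi * v) / 2 + \<epsilon> * gy n a x v - (cot (pi * u) / 2 + \<epsilon> * gy n a x u)
          = (v - u) * (- (pi / (sin (pi * z))\<^sup>2) / 2 + \<epsilon> * gyy n a x z)"
        using MVT2[OF \<open>u < v\<close> D] by blast
      have y': "\<bar>z - 1/2\<bar> \<le> 1/4" "0 < z" "z < 1" using that z \<delta> by linarith+
      have "\<bar>\<epsilon> * gyy n a x z\<bar> \<le> \<bar>\<epsilon>\<bar> * M"
        unfolding abs_mult using M(2)[OF y'(1)] by (simp add: mult_left_mono)
      also have "\<dots> \<le> 1 / 2" using elim(1) M(1) by (simp add: field_simps)
      finally have "- pi / (2 * (sin (pi * z))\<^sup>2) + \<epsilon> * gyy n a x z < 0"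
        using R0_second_deriv_le[OF y'(2,3)] pi_ge_two by linarith
      then have "(v - u) * (- (pi / (sin (pi * z))\<^sup>2) / 2 + \<epsilon> * gyy n a x z) \<noteq> 0"
        using that(1) by (simp add: mult.commute)
      then show False using z(3) unfolding that(4,5) by simp
    qed
    show ?case
    proof (intro allI impI)
      fix x y y'
      assume "\<bar>y - 1/2\<bar> < \<delta>" "\<bar>y' - 1/2\<bar> < \<delta>"
        "cot (pi * y) / 2 + \<epsilon> * gy n a x y = 0" "cot (pi * y') / 2 + \<epsilon> * gy n a x y' = 0"
      then show "y = y'"
        using no[of y y' x] no[of y' y x] by (cases y y' rule: linorder_cases) auto
    qed
  qed
qed

subsection \<open>Branches of critical points\<close>

lemma root_curve:
  assumes n: "1 \<le> n" and a: "a \<noteq> 0" and c: "-1 < c" "c < 1"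
    and root: "poly (cheb_U (n - 1)) c = Lam n a"
    and simple: "poly (pderiv (cheb_U (n - 1))) c \<noteq> 0"
  obtains d \<gamma> where "0 < d" "d \<le> 1/4" "continuous_on {1/2 - d..1/2 + d} \<gamma>"
    "\<gamma> differentiable (at (1/2))" "\<gamma> (1/2) = c"
    "\<And>y. \<bar>y - 1/2\<bar> \<le> d \<Longrightarrow> -1 < \<gamma> y \<and> \<gamma> y < 1 \<and>
       B 1 y + a * real n * B n y * poly (cheb_U (n - 1)) (\<gamma> y) = 0"
proof -
  \<comment> \<open>The value that \<open>cheb_U (n - 1)\<close> must take at height
    \<open>y\<close>; composing it with the local inverse \<open>\<phi>\<close> gives the
    curve.\<close>
  define w where "w = (\<lambda>y. - B 1 y / (a * real n * B n y))"
  obtain V \<phi> where V: "open V" "Lam n a \<in> V" "\<phi> (Lam n a) = c"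
    "\<And>v. v \<in> V \<Longrightarrow> poly (cheb_U (n - 1)) (\<phi> v) = v" "\<And>v. v \<in> V \<Longrightarrow> \<phi> differentiable (at v)"
    using inverse_poly[OF simple] unfolding root by blast
  have w_half: "w (1/2) = Lam n a" unfolding w_def Lam_eq[OF n a] ..
  have w_diff: "w differentiable (at y)" if "0 < y" "y < 1" "B n y \<noteq> 0" for y
    unfolding w_def using that a n DERIV_B[of y] by (intro derivative_intros) (auto simp: real_differentiable_def)
  have Bn: "B n (1/2) \<noteq> 0" using B_half_pos[OF n] by simp
  have w_cont: "isCont w (1/2)"
    using w_diff[of "1/2"] Bn by (simp add: differentiable_imp_continuous_within)
  have "isCont \<phi> (w (1/2))"
    using V(5)[OF V(2)] unfolding w_half by (rule differentiable_imp_continuous_within)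
  with w_cont have "isCont (\<lambda>y. \<phi> (w y)) (1/2)" by (rule isCont_o2)
  then have 1: "((\<lambda>y. \<phi> (w y)) \<longlongrightarrow> c) (at (1/2))" by (simp add: isCont_def w_half V(3))
  have 2: "(w \<longlongrightarrow> Lam n a) (at (1/2))" using w_cont by (simp add: isCont_def w_half)
  have 3: "(B n \<longlongrightarrow> B n (1/2)) (at (1/2))" using isCont_B[of "1/2" n] by (simp add: isCont_def)
  have "\<forall>\<^sub>F y in at (1/2). w y \<in> V \<and> -1 < \<phi> (w y) \<and> \<phi> (w y) < 1 \<and> 0 < B n y"
    by (intro eventually_conj topological_tendstoD[OF 2 V(1,2)] order_tendstoD(1)[OF 1 c(1)]
        order_tendstoD(2)[OF 1 c(2)] order_tendstoD(1)[OF 3 B_half_pos[OF n]])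
  then obtain d where d: "0 < d"
    "\<And>y. y \<noteq> 1/2 \<Longrightarrow> \<bar>y - 1/2\<bar> < d \<Longrightarrow> w y \<in> V \<and> -1 < \<phi> (w y) \<and> \<phi> (w y) < 1 \<and> 0 < B n y"
    unfolding eventually_at by (auto simp: dist_real_def)
  have near: "w y \<in> V \<and> -1 < \<phi> (w y) \<and> \<phi> (w y) < 1 \<and> 0 < B n y" if "\<bar>y - 1/2\<bar> < d" for y
  proof (cases "y = 1/2")
    case True
    show ?thesis unfolding True w_half V(3) using V(2) c B_half_pos[OF n] by simp
  qed (use d(2) that in blast)
  show thesis
  \<comment> \<open>Halving \<open>d\<close> passes from the open to a closed interval, and 1/4
    keeps the heights inside (0, 1).\<close>
  proof (rule that[of "min (d / 2) (1/4)" "\<lambda>y. \<phi> (w y)"])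
    have diff: "(\<lambda>y. \<phi> (w y)) differentiable (at y)" if "\<bar>y - 1/2\<bar> < d" "0 < y" "y < 1" for y
      by (rule differentiable_compose) (use near[OF that(1)] that V(5) w_diff[of y] in auto)
    show "continuous_on {1/2 - min (d / 2) (1/4)..1/2 + min (d / 2) (1/4)} (\<lambda>y. \<phi> (w y))"
    proof (intro continuous_at_imp_continuous_on ballI differentiable_imp_continuous_within diff)
      fix y assume "y \<in> {1/2 - min (d / 2) (1/4)..1/2 + min (d / 2) (1/4)}"
      then have "1/2 - min (d / 2) (1/4) \<le> y" "y \<le> 1/2 + min (d / 2) (1/4)" by auto
      then show "\<bar>y - 1/2\<bar> < d" "0 < y" "y < 1" using d(1) by linarith+
    qed
    show "(\<lambda>y. \<phi> (w y)) differentiable (at (1/2))" using d(1) by (intro diff) auto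
    show "\<phi> (w (1/2)) = c" by (simp add: w_half V(3))
    fix y :: real assume "\<bar>y - 1/2\<bar> \<le> min (d / 2) (1/4)"
    then have y: "\<bar>y - 1/2\<bar> < d" using d(1) by linarith
    have "poly (cheb_U (n - 1)) (\<phi> (w y)) = - B 1 y / (a * real n * B n y)"
      using V(4) near[OF y] by (simp add: w_def)
    then show "-1 < \<phi> (w y) \<and> \<phi> (w y) < 1 \<and>
        B 1 y + a * real n * B n y * poly (cheb_U (n - 1)) (\<phi> (w y)) = 0"
      using near[OF y] a n by simp
  qed (use d(1) in auto)
qed

lemma root_branch:
  assumes n: "1 \<le> n" and a: "a \<noteq> 0" and c: "-1 < c" "c < 1"
    and root: "poly (cheb_U (n - 1)) c = Lam n a"
    and simple: "poly (pderiv (cheb_U (n - 1))) c \<noteq> 0"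
  shows "\<exists>C Y.
    (\<lambda>\<epsilon>. arccos (C \<epsilon>) - arccos c) \<in> O[at 0](\<lambda>\<epsilon>. \<epsilon>) \<and> (C \<longlongrightarrow> c) (at 0) \<and>
    (\<lambda>\<epsilon>. Y \<epsilon> - (1/2 + \<epsilon> * Yshift n a c)) \<in> O[at 0](\<lambda>\<epsilon>. \<epsilon>\<^sup>2) \<and> (Y \<longlongrightarrow> 1/2) (at 0) \<and>
    (\<forall>\<^sub>F \<epsilon> in at 0. -1 < C \<epsilon> \<and> C \<epsilon> < 1 \<and>
       B 1 (Y \<epsilon>) + a * real n * B n (Y \<epsilon>) * poly (cheb_U (n - 1)) (C \<epsilon>) = 0 \<and>
       cot (pi * Y \<epsilon>) / 2 + \<epsilon> * (B' 1 (Y \<epsilon>) * C \<epsilon> + a * B' n (Y \<epsilon>) * poly (cheb_T n) (C \<epsilon>)) = 0)"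
proof -
  obtain d \<gamma> where d: "0 < d" "d \<le> 1/4" and \<gamma>: "continuous_on {1/2 - d..1/2 + d} \<gamma>"
    "\<gamma> differentiable (at (1/2))" "\<gamma> (1/2) = c"
    "\<And>y. \<bar>y - 1/2\<bar> \<le> d \<Longrightarrow> -1 < \<gamma> y \<and> \<gamma> y < 1 \<and>
       B 1 y + a * real n * B n y * poly (cheb_U (n - 1)) (\<gamma> y) = 0"
    using root_curve[OF assms] by blast
  obtain Y where Y: "\<forall>\<^sub>F \<epsilon> in at 0. \<bar>Y \<epsilon> - 1/2\<bar> \<le> d \<and>
       cot (pi * Y \<epsilon>) / 2 + \<epsilon> * (B' 1 (Y \<epsilon>) * \<gamma> (Y \<epsilon>) + a * B' n (Y \<epsilon>) * poly (cheb_T n) (\<gamma> (Y \<epsilon>))) = 0"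
    "(Y \<longlongrightarrow> 1/2) (at 0)" "(\<lambda>\<epsilon>. Y \<epsilon> - 1/2) \<in> O[at 0](\<lambda>\<epsilon>. \<epsilon>)"
    "(\<lambda>\<epsilon>. Y \<epsilon> - (1/2 + \<epsilon> * Yshift n a (\<gamma> (1/2)))) \<in> O[at 0](\<lambda>\<epsilon>. \<epsilon>\<^sup>2)"
    using solve_y[OF n d \<gamma>(1,2), where a = a] by blast
  have "arccos differentiable (at c)"
    using DERIV_arccos[OF c] by (auto simp: real_differentiable_def)
  \<comment> \<open>The root is interior, so arccos is differentiable at \<open>c\<close>, and the
    O(\<epsilon>) bound on the height carries over to the horizontal coordinate.\<close>
  then have ac: "(\<lambda>y. arccos (\<gamma> y)) differentiable (at (1/2))"
    by - (rule differentiable_compose[of arccos], use \<gamma>(2,3) in auto)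
  have 1: "(\<lambda>\<epsilon>. arccos (\<gamma> (Y \<epsilon>)) - arccos c) \<in> O[at 0](\<lambda>\<epsilon>. \<epsilon>)"
    using landau_o.big_trans[OF differentiable_bigo[OF ac Y(2)] Y(3)] by (simp add: \<gamma>(3))
  have 2: "((\<lambda>\<epsilon>. \<gamma> (Y \<epsilon>)) \<longlongrightarrow> c) (at 0)"
    using isCont_tendsto_compose[OF differentiable_imp_continuous_within[OF \<gamma>(2)] Y(2)] \<gamma>(3) by simp
  have 3: "\<forall>\<^sub>F \<epsilon> in at 0. -1 < \<gamma> (Y \<epsilon>) \<and> \<gamma> (Y \<epsilon>) < 1 \<and>
       B 1 (Y \<epsilon>) + a * real n * B n (Y \<epsilon>) * poly (cheb_U (n - 1)) (\<gamma> (Y \<epsilon>)) = 0 \<and>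
       cot (pi * Y \<epsilon>) / 2 + \<epsilon> * (B' 1 (Y \<epsilon>) * \<gamma> (Y \<epsilon>) + a * B' n (Y \<epsilon>) * poly (cheb_T n) (\<gamma> (Y \<epsilon>))) = 0"
    using Y(1)
  proof eventually_elim
    case (elim \<epsilon>)
    then show ?case using \<gamma>(4)[of "Y \<epsilon>"] by blast
  qed
  show ?thesis
    by (rule exI[of _ "\<lambda>\<epsilon>. \<gamma> (Y \<epsilon>)"], rule exI[of _ Y]) (use 1 2 3 Y(2,4) \<gamma>(3) in auto)
qed

section \<open>Axes, congruence modulo 2 pi and the final assembly\<close>

lemma poly_cheb_T_1: "poly (cheb_T n) 1 = 1"
  using poly_cheb_T_cos[of n 0] by simp

lemma poly_cheb_T_minus_1: "poly (cheb_T n) (-1) = (-1) ^ n"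
  using poly_cheb_T_cos[of n pi] by simp

lemma axial_cases:
  assumes "axial (x, y)"
  obtains "[x = 0] (rmod (2 * pi))" "cos x = 1" | "[x = pi] (rmod (2 * pi))" "cos x = -1"
proof -
  obtain m :: int where m: "x = of_int m * pi" using assms by (auto simp: axial_def)
  show thesis
  proof (cases "even m")
    case True
    then obtain k where k: "m = 2 * k" by blast
    then have "0 = x + of_int (- k) * (2 * pi)" by (simp add: m)
    then have x: "[x = 0] (rmod (2 * pi))" unfolding rcong_altdef by blast
    show thesis using that(1)[OF x] cos_rcong[OF x] by simp
  next
    case False
    then obtain k where k: "m = 2 * k + 1" by (elim oddE)
    then have "pi = x + of_int (- k) * (2 * pi)" by (simp add: m algebra_simps)
    then have x: "[x = pi] (rmod (2 * pi))" unfolding rcong_altdef by blast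
    show thesis using that(2)[OF x] cos_rcong[OF x] by simp
  qed
qed

lemma not_axial_mult_arccos:
  assumes c: "-1 < c" "c < 1" and s: "s \<in> {1, -1}"
  shows "\<not> axial (s * arccos c, y)"
proof
  assume "axial (s * arccos c, y)"
  then have "cos (s * arccos c) \<in> {1, -1}" by (rule axial_cases) auto
  then show False using c s by auto
qed

text \<open>Both numbers lie strictly between - pi and pi, where congruence is equality. As arccos
  is positive here, the signs agree, and the cosine recovers the root.\<close>

lemma mult_arccos_rcong_imp_eq:
  assumes c: "-1 < c" "c < 1" "-1 < c'" "c' < 1" and s: "s \<in> {1, -1}" "s' \<in> {1, -1}"
    and cong: "[s * arccos c = s' * arccos c'] (rmod (2 * pi))"
  shows "c = c' \<and> s = s'"
proof -
  have b: "0 < arccos c" "arccos c < pi" "0 < arccos c'" "arccos c' < pi"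
    using arccos_lt_bounded[OF c(1,2)] arccos_lt_bounded[OF c(3,4)] by auto
  have eq: "s * arccos c = s' * arccos c'"
    by (rule rcong_imp_eq[OF cong]) (use b s in \<open>auto simp: abs_if\<close>)
  then have "s = s'" using b s by auto
  moreover have "cos (s * arccos c) = cos (s' * arccos c')" using eq by simp
  then have "c = c'" using c s by auto
  ultimately show ?thesis by simp
qed

theorem proposition6p1:
  fixes n :: nat and a :: real
  assumes "n \<ge> 2" and "a \<noteq> 0"
    and "\<And>c. \<lbrakk>-1 < c; c < 1; poly (cheb_U (n - 1)) c = Lam n a\<rbrakk>
           \<Longrightarrow> poly (pderiv (cheb_U (n - 1))) c \<noteq> 0"
    and "Lam n a \<notin> {real n, (-1) ^ (n - 1) * real n}"
  defines "roots \<equiv> {c. -1 < c \<and> c < 1 \<and> poly (cheb_U (n - 1)) c = Lam n a}"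
    and "crit \<equiv> (\<lambda>\<delta> \<epsilon>. critical_points (R_approx n a \<epsilon>) (midstrip \<delta>))"
  shows "\<exists>\<delta>. 0 < \<delta> \<and> \<delta> \<le> 1 / 2 \<and>
    (\<exists>(y0 :: real \<Rightarrow> real) (y\<pi> :: real \<Rightarrow> real)
      (X :: real \<Rightarrow> real \<Rightarrow> real \<Rightarrow> real) (Y :: real \<Rightarrow> real \<Rightarrow> real \<Rightarrow> real).
      \<comment> \<open>asymptotics as \<open>\<epsilon> \<rightarrow> 0\<close>;
          \<open>(X s c \<epsilon>, Y s c \<epsilon>)\<close> is the non-axial point with sign \<open>s = \<plusminus>1\<close> and root \<open>c\<close>\<close>
      (\<lambda>\<epsilon>. y0 \<epsilon> - (1 / 2 + \<epsilon> / (2 * pi\<^sup>2) *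
          ((1 + pi\<^sup>2) / cosh (1 / 2) + a * (((real n)\<^sup>2 + pi\<^sup>2) / cosh (real n / 2)))))
        \<in> O[at 0](\<lambda>\<epsilon>. \<epsilon>\<^sup>2) \<and>
      (\<lambda>\<epsilon>. y\<pi> \<epsilon> - (1 / 2 - \<epsilon> / (2 * pi\<^sup>2) *
          ((1 + pi\<^sup>2) / cosh (1 / 2) - a * (-1) ^ n * (((real n)\<^sup>2 + pi\<^sup>2) / cosh (real n / 2)))))
        \<in> O[at 0](\<lambda>\<epsilon>. \<epsilon>\<^sup>2) \<and>
      (\<forall>c\<in>roots. \<forall>s\<in>{1, -1}.
        (\<lambda>\<epsilon>. X s c \<epsilon> - s * arccos c) \<in> O[at 0](\<lambda>\<epsilon>. \<epsilon>) \<and>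
        (\<lambda>\<epsilon>. Y s c \<epsilon> - (1 / 2 + \<epsilon> * Yshift n a c)) \<in> O[at 0](\<lambda>\<epsilon>. \<epsilon>\<^sup>2)) \<and>
      (\<forall>\<^sub>F \<epsilon> in at 0.
        (\<forall>p\<in>crit \<delta> \<epsilon>. p isolated_in crit \<delta> \<epsilon> \<and> nondegenerate_at (R_approx n a \<epsilon>) p) \<and>
        \<comment> \<open>modulo \<open>2 \<pi>\<close> in \<open>x\<close> there are exactly two axial critical points\<close>
        (0, y0 \<epsilon>) \<in> crit \<delta> \<epsilon> \<and> (pi, y\<pi> \<epsilon>) \<in> crit \<delta> \<epsilon> \<and>
        (\<forall>x y. (x, y) \<in> crit \<delta> \<epsilon> \<and> axial (x, y) \<longrightarrow>
          [x = 0] (rmod (2 * pi)) \<and> y = y0 \<epsilon> \<or> [x = pi] (rmod (2 * pi)) \<and> y = y\<pi> \<epsilon>) \<and>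
        (\<forall>c\<in>roots. \<forall>s\<in>{1, -1}.
          (X s c \<epsilon>, Y s c \<epsilon>) \<in> crit \<delta> \<epsilon> \<and> \<not> axial (X s c \<epsilon>, Y s c \<epsilon>)) \<and>
        \<comment> \<open>the non-axial points generated are pairwise distinct modulo \<open>2 \<pi>\<close> in \<open>x\<close>\<close>
        (\<forall>c\<in>roots. \<forall>s\<in>{1, -1}. \<forall>c'\<in>roots. \<forall>s'\<in>{1, -1}.
          [X s c \<epsilon> = X s' c' \<epsilon>] (rmod (2 * pi)) \<and> Y s c \<epsilon> = Y s' c' \<epsilon> \<longrightarrow>
            c = c' \<and> s = s')))"
proof -
  have n: "1 \<le> n" using assms(1) by simp
  note a = assms(2) and simple = assms(3) and ends = assms(4)
  \<comment> \<open>Finitely many roots allow one range of \<open>\<epsilon>\<close> for all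
    branches. If \<open>cheb_U (n - 1)\<close> were constantly \<open>Lam n a\<close>, its
    derivative would vanish, and \<open>simple\<close> would leave no root at all.\<close>
  have fin: "finite roots"
  proof (cases "cheb_U (n - 1) - [:Lam n a:] = 0")
    case True
    then have "cheb_U (n - 1) = [:Lam n a:]" by simp
    then have "pderiv (cheb_U (n - 1)) = 0" by (simp add: pderiv_pCons)
    then have "roots = {}" using simple by (auto simp: roots_def)
    then show ?thesis by simp
  next
    case False
    then have "finite {c. poly (cheb_U (n - 1) - [:Lam n a:]) c = 0}" by (rule poly_roots_finite)
    then show ?thesis by (rule rev_finite_subset) (auto simp: roots_def)
  qed
  obtain \<delta> \<kappa> where \<delta>: "0 < \<delta>" "\<delta> \<le> 1/4" and \<kappa>: "0 < \<kappa>"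
    and lower: "\<And>x y. \<lbrakk>\<bar>y - 1/2\<bar> < \<delta>; gx n a x y = 0\<rbrakk> \<Longrightarrow> \<kappa> \<le> \<bar>gxx n a x y\<bar>"
    using gxx_bounded_below[OF n a simple ends] by blast
  obtain y0 where y0: "\<forall>\<^sub>F \<epsilon> in at 0. \<bar>y0 \<epsilon> - 1/2\<bar> \<le> 1/4 \<and>
       cot (pi * y0 \<epsilon>) / 2 + \<epsilon> * (B' 1 (y0 \<epsilon>) * 1 + a * B' n (y0 \<epsilon>) * poly (cheb_T n) 1) = 0"
    "(y0 \<longlongrightarrow> 1/2) (at 0)"
    "(\<lambda>\<epsilon>. y0 \<epsilon> - (1/2 + \<epsilon> * Yshift n a 1)) \<in> O[at 0](\<lambda>\<epsilon>. \<epsilon>\<^sup>2)"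
    using solve_y[OF n _ _ continuous_on_const[of _ 1] differentiable_const, of "1/4" a] by auto
  obtain y\<pi> where y\<pi>: "\<forall>\<^sub>F \<epsilon> in at 0. \<bar>y\<pi> \<epsilon> - 1/2\<bar> \<le> 1/4 \<and>
       cot (pi * y\<pi> \<epsilon>) / 2 + \<epsilon> * (B' 1 (y\<pi> \<epsilon>) * (-1) + a * B' n (y\<pi> \<epsilon>) * poly (cheb_T n) (-1)) = 0"
    "(y\<pi> \<longlongrightarrow> 1/2) (at 0)"
    "(\<lambda>\<epsilon>. y\<pi> \<epsilon> - (1/2 + \<epsilon> * Yshift n a (-1))) \<in> O[at 0](\<lambda>\<epsilon>. \<epsilon>\<^sup>2)"
    using solve_y[OF n _ _ continuous_on_const[of _ "-1"] differentiable_const, of "1/4" a] by auto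
  define P where "P = (\<lambda>c (C :: real \<Rightarrow> real) (Y :: real \<Rightarrow> real).
    (\<lambda>\<epsilon>. arccos (C \<epsilon>) - arccos c) \<in> O[at 0](\<lambda>\<epsilon>. \<epsilon>) \<and> (C \<longlongrightarrow> c) (at 0) \<and>
    (\<lambda>\<epsilon>. Y \<epsilon> - (1/2 + \<epsilon> * Yshift n a c)) \<in> O[at 0](\<lambda>\<epsilon>. \<epsilon>\<^sup>2) \<and> (Y \<longlongrightarrow> 1/2) (at 0) \<and>
    (\<forall>\<^sub>F \<epsilon> in at 0. -1 < C \<epsilon> \<and> C \<epsilon> < 1 \<and>
       B 1 (Y \<epsilon>) + a * real n * B n (Y \<epsilon>) * poly (cheb_U (n - 1)) (C \<epsilon>) = 0 \<and>
       cot (pi * Y \<epsilon>) / 2 + \<epsilon> * (B' 1 (Y \<epsilon>) * C \<epsilon> + a * B' n (Y \<epsilon>) * poly (cheb_T n) (C \<epsilon>)) = 0))"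
  have "\<exists>C Y. P c C Y" if "c \<in> roots" for c
    unfolding P_def by (rule root_branch[OF n a]) (use that simple in \<open>auto simp: roots_def\<close>)
  then obtain C Y where "\<And>c. c \<in> roots \<Longrightarrow> P c (C c) (Y c)"
    by metis
  note CY = this[unfolded P_def]
  have near: "\<forall>\<^sub>F \<epsilon> in at 0. \<bar>y \<epsilon> - 1/2\<bar> < \<delta>" if "(y \<longlongrightarrow> 1/2) (at 0)" for y :: "real \<Rightarrow> real"
    using tendstoD[OF that \<delta>(1)] by (simp add: dist_real_def)
  have crit_iff: "(x, y) \<in> crit \<delta> \<epsilon> \<longleftrightarrow> \<bar>y - 1/2\<bar> < \<delta> \<and>
      sin x * (B 1 y + a * real n * B n y * poly (cheb_U (n - 1)) (cos x)) = 0 \<and>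
      cot (pi * y) / 2 + \<epsilon> * (B' 1 y * cos x + a * B' n y * poly (cheb_T n) (cos x)) = 0"
    if "\<epsilon> \<noteq> 0" for x y \<epsilon>
    unfolding crit_def critical_points_iff[OF n \<delta>(2) that] gx_cheb[OF n] gy_cheb by simp
  have ev_roots: "\<forall>\<^sub>F \<epsilon> in at 0. \<forall>c\<in>roots. \<bar>Y c \<epsilon> - 1/2\<bar> < \<delta> \<and> -1 < C c \<epsilon> \<and> C c \<epsilon> < 1 \<and>
       B 1 (Y c \<epsilon>) + a * real n * B n (Y c \<epsilon>) * poly (cheb_U (n - 1)) (C c \<epsilon>) = 0 \<and>
       cot (pi * Y c \<epsilon>) / 2 + \<epsilon> * (B' 1 (Y c \<epsilon>) * C c \<epsilon> + a * B' n (Y c \<epsilon>) * poly (cheb_T n) (C c \<epsilon>)) = 0"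
  proof (intro eventually_ball_finite[OF fin] ballI)
    fix c assume "c \<in> roots"
    note lim_ev = CY[OF this, THEN conjunct2, THEN conjunct2, THEN conjunct2]
    show "\<forall>\<^sub>F \<epsilon> in at 0. \<bar>Y c \<epsilon> - 1/2\<bar> < \<delta> \<and> -1 < C c \<epsilon> \<and> C c \<epsilon> < 1 \<and>
       B 1 (Y c \<epsilon>) + a * real n * B n (Y c \<epsilon>) * poly (cheb_U (n - 1)) (C c \<epsilon>) = 0 \<and>
       cot (pi * Y c \<epsilon>) / 2 + \<epsilon> * (B' 1 (Y c \<epsilon>) * C c \<epsilon> + a * B' n (Y c \<epsilon>) * poly (cheb_T n) (C c \<epsilon>)) = 0"
      using near[OF lim_ev[THEN conjunct1]] lim_ev[THEN conjunct2] by (rule eventually_conj)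
  qed
  \<comment> \<open>Different branches have different limits \<open>c\<close> and \<open>c'\<close>,
    so they separate for small \<open>\<epsilon>\<close>.\<close>
  have ev_distinct: "\<forall>\<^sub>F \<epsilon> in at 0. \<forall>c\<in>roots. \<forall>c'\<in>roots. C c \<epsilon> = C c' \<epsilon> \<longrightarrow> c = c'"
  proof (intro eventually_ball_finite[OF fin] ballI)
    fix c c' assume cc: "c \<in> roots" "c' \<in> roots"
    show "\<forall>\<^sub>F \<epsilon> in at 0. C c \<epsilon> = C c' \<epsilon> \<longrightarrow> c = c'"
    proof (cases "c = c'")
      case False
      have "((\<lambda>\<epsilon>. C c \<epsilon> - C c' \<epsilon>) \<longlongrightarrow> c - c') (at 0)"
        using CY[OF cc(1)] CY[OF cc(2)] by (intro tendsto_diff) auto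
      then have "\<forall>\<^sub>F \<epsilon> in at 0. C c \<epsilon> - C c' \<epsilon> \<noteq> 0"
        using False by (intro tendsto_imp_eventually_ne) auto
      then show ?thesis by eventually_elim auto
    qed auto
  qed
  have ev_Jac: "\<forall>\<^sub>F \<epsilon> in at 0. \<forall>x y. \<bar>y - 1/2\<bar> < \<delta> \<longrightarrow> gx n a x y = 0 \<longrightarrow> Jac n a \<epsilon> x y \<noteq> 0"
    using lower by (rule eventually_Jac_nonzero[OF \<delta>(2) \<kappa>])
  have cos_s: "cos (s * arccos c) = c" if "s \<in> {1, -1}" "-1 < c" "c < 1" for s c :: real
    using that by auto
  have \<delta>_half: "\<delta> \<le> 1/2" using \<delta>(2) by simp
  \<comment> \<open>The equations are even in \<open>x\<close>, so the two signs of a root share the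
    height \<open>Y c\<close> and differ only in the sign of arccos.\<close>
  show ?thesis
  proof (rule exI[of _ \<delta>], rule conjI[OF \<delta>(1)], rule conjI[OF \<delta>_half], rule exI[of _ y0], rule exI[of _ y\<pi>],
      rule exI[of _ "\<lambda>s c \<epsilon>. s * arccos (C c \<epsilon>)"], rule exI[of _ "\<lambda>s c. Y c"], intro conjI)
    show "(\<lambda>\<epsilon>. y0 \<epsilon> - (1 / 2 + \<epsilon> / (2 * pi\<^sup>2) *
          ((1 + pi\<^sup>2) / cosh (1 / 2) + a * (((real n)\<^sup>2 + pi\<^sup>2) / cosh (real n / 2)))))
        \<in> O[at 0](\<lambda>\<epsilon>. \<epsilon>\<^sup>2)"
      using y0(3) by (simp add: Yshift_def poly_cheb_T_1)
    show "(\<lambda>\<epsilon>. y\<pi> \<epsilon> - (1 / 2 - \<epsilon> / (2 * pi\<^sup>2) *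
          ((1 + pi\<^sup>2) / cosh (1 / 2) - a * (-1) ^ n * (((real n)\<^sup>2 + pi\<^sup>2) / cosh (real n / 2)))))
        \<in> O[at 0](\<lambda>\<epsilon>. \<epsilon>\<^sup>2)"
    proof -
      have "1 / 2 - \<epsilon> / (2 * pi\<^sup>2) *
          ((1 + pi\<^sup>2) / cosh (1 / 2) - a * (-1) ^ n * (((real n)\<^sup>2 + pi\<^sup>2) / cosh (real n / 2)))
        = 1/2 + \<epsilon> * Yshift n a (-1)" for \<epsilon>
        unfolding Yshift_def poly_cheb_T_minus_1 by (simp add: field_simps)
      then show ?thesis using y\<pi>(3) by (simp only:)
    qed
    show "\<forall>c\<in>roots. \<forall>s\<in>{1, -1}.
        (\<lambda>\<epsilon>. s * arccos (C c \<epsilon>) - s * arccos c) \<in> O[at 0](\<lambda>\<epsilon>. \<epsilon>) \<and>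
        (\<lambda>\<epsilon>. Y c \<epsilon> - (1 / 2 + \<epsilon> * Yshift n a c)) \<in> O[at 0](\<lambda>\<epsilon>. \<epsilon>\<^sup>2)"
    proof (intro ballI conjI)
      fix c and s :: real assume c: "c \<in> roots" and s: "s \<in> {1, -1}"
      show "(\<lambda>\<epsilon>. s * arccos (C c \<epsilon>) - s * arccos c) \<in> O[at 0](\<lambda>\<epsilon>. \<epsilon>)"
        unfolding right_diff_distrib[symmetric] using CY[OF c] s by auto
      show "(\<lambda>\<epsilon>. Y c \<epsilon> - (1 / 2 + \<epsilon> * Yshift n a c)) \<in> O[at 0](\<lambda>\<epsilon>. \<epsilon>\<^sup>2)"
        using CY[OF c] by blast
    qed
    have "\<forall>\<^sub>F \<epsilon> in at (0::real). \<epsilon> \<noteq> 0" by (rule eventually_neq_at_within)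
    then show "\<forall>\<^sub>F \<epsilon> in at 0.
        (\<forall>p\<in>crit \<delta> \<epsilon>. p isolated_in crit \<delta> \<epsilon> \<and> nondegenerate_at (R_approx n a \<epsilon>) p) \<and>
        (0, y0 \<epsilon>) \<in> crit \<delta> \<epsilon> \<and> (pi, y\<pi> \<epsilon>) \<in> crit \<delta> \<epsilon> \<and>
        (\<forall>x y. (x, y) \<in> crit \<delta> \<epsilon> \<and> axial (x, y) \<longrightarrow>
          [x = 0] (rmod (2 * pi)) \<and> y = y0 \<epsilon> \<or> [x = pi] (rmod (2 * pi)) \<and> y = y\<pi> \<epsilon>) \<and>
        (\<forall>c\<in>roots. \<forall>s\<in>{1, -1}.
          (s * arccos (C c \<epsilon>), Y c \<epsilon>) \<in> crit \<delta> \<epsilon> \<and> \<not> axial (s * arccos (C c \<epsilon>), Y c \<epsilon>)) \<and>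
        (\<forall>c\<in>roots. \<forall>s\<in>{1, -1}. \<forall>c'\<in>roots. \<forall>s'\<in>{1, -1}.
          [s * arccos (C c \<epsilon>) = s' * arccos (C c' \<epsilon>)] (rmod (2 * pi)) \<and> Y c \<epsilon> = Y c' \<epsilon> \<longrightarrow>
            c = c' \<and> s = s')"
      using y0(1) near[OF y0(2)] y\<pi>(1) near[OF y\<pi>(2)] ev_roots ev_distinct
        ev_Jac eventually_unique_y[OF \<delta>(2), of n a]
    proof eventually_elim
      case (elim \<epsilon>)
      note crit = crit_iff[OF elim(1)]
      have c0: "(0, y0 \<epsilon>) \<in> crit \<delta> \<epsilon>" and c\<pi>: "(pi, y\<pi> \<epsilon>) \<in> crit \<delta> \<epsilon>"
        unfolding crit using elim(2-5) by simp_all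
      \<comment> \<open>The vertical equation sees \<open>x\<close> only through cos x, so critical
        points with equal cosine have equal height. Comparison with \<open>c0\<close> and
        \<open>c\<pi>\<close> then pins down all axial points.\<close>
      have uniq: "y = y'" if "(x, y) \<in> crit \<delta> \<epsilon>" "(x', y') \<in> crit \<delta> \<epsilon>" "cos x = cos x'" for x x' y y'
        using elim(9)[rule_format, of y y' x] that unfolding crit gy_cheb by simp
      have iso: "p isolated_in crit \<delta> \<epsilon> \<and> nondegenerate_at (R_approx n a \<epsilon>) p" if "p \<in> crit \<delta> \<epsilon>" for p
      proof (cases p)
        case (Pair x y)
        have xy: "\<bar>y - 1/2\<bar> < \<delta>" "gx n a x y = 0"
          using that critical_points_iff[OF n \<delta>(2) elim(1), of x y a] unfolding crit_def Pair by auto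
        then have J: "Jac n a \<epsilon> x y \<noteq> 0" using elim(8) by blast
        have y: "1/4 < y" "y < 3/4" using xy(1) \<delta>(2) by linarith+
        show ?thesis
          using isolated_critical_point[OF n \<delta>(2) elim(1) J] that
            nondegenerate_at_R_approx[OF n y elim(1) J]
          unfolding Pair crit_def by blast
      qed
      have ax: "[x = 0] (rmod (2 * pi)) \<and> y = y0 \<epsilon> \<or> [x = pi] (rmod (2 * pi)) \<and> y = y\<pi> \<epsilon>"
        if "(x, y) \<in> crit \<delta> \<epsilon>" "axial (x, y)" for x y
        using that(2)
      proof (cases rule: axial_cases)
        case 1
        then show ?thesis using uniq[OF that(1) c0] by simp
      next
        case 2
        then show ?thesis using uniq[OF that(1) c\<pi>] by simp
      qed
      have nonax: "(s * arccos (C c \<epsilon>), Y c \<epsilon>) \<in> crit \<delta> \<epsilon> \<and> \<not> axial (s * arccos (C c \<epsilon>), Y c \<epsilon>)"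
        if c: "c \<in> roots" and s: "s \<in> {1, -1}" for c s
      proof -
        note e = elim(6)[rule_format, OF c]
        have C: "-1 < C c \<epsilon>" "C c \<epsilon> < 1" using e by auto
        show ?thesis
          unfolding crit cos_s[OF s C] using e not_axial_mult_arccos[OF C s] by simp
      qed
      have dist: "c = c' \<and> s = s'"
        if c: "c \<in> roots" "c' \<in> roots" and s: "s \<in> {1, -1}" "s' \<in> {1, -1}"
          and cong: "[s * arccos (C c \<epsilon>) = s' * arccos (C c' \<epsilon>)] (rmod (2 * pi))" for c c' s s'
        using mult_arccos_rcong_imp_eq[OF _ _ _ _ s cong] elim(6)[rule_format, OF c(1)]
          elim(6)[rule_format, OF c(2)] elim(7)[rule_format, OF c] by blast
      show ?case
        by (intro conjI ballI allI impI c0 c\<pi>; (elim conjE)?)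
          (simp_all only: iso ax nonax dist not_False_eq_True)
    qed
  qed
qed

end
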